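(* There are exactly $43$ $\mathrm{Sp}(6,2)$-orbits of compatible collections of subspaces of $E_3$.
   Context: $E_3$ is the set of even-cardinality subsets of $\{A,B,C,D,E,F,G,H\}$ modulo the equivalence $I\sim$ complement of $I$. It is a 6-dimensional $\mathbb F_2$-vector space with addition the symmetric difference, equipped with the symplectic pairing $\langle I,J\rangle=|I\cap J|\bmod2$; $\mathrm{Sp}(6,2)$ is the group of linear automorphisms of $E_3$ preserving the pairing, and it acts on sets of pairs of subspaces. Let $\mathcal L$ be a set of pairs $(X,X^\perp)$ of orthogonally complementary subspaces of $E_3$, ordered so that $\dim X\le\dim X^\perp$ (the order is immaterial when both have dimension 3). $\mathcal L$ is called compatible when - $(\mathbf 0,E_3)\in\mathcal L$; - for all $(X,X^\perp)\in\mathcal L$, either $\dim X\le1$ or $X$ is not isotropic; - for all distinct pairs $(X,X^\perp),(Y,Y^\perp)\in\mathcal L$, we have $X\subset Y$, $Y\subset X$ or $X\subset Y^\perp$; - for all distinct pairs $(X,X^\perp),(Y,Y^\perp)\in\mathcal L\setminus\{(\mathbf 0,E_3)\}$, neither $X\subset Y\cap Y^\perp$ nor $Y\subset X\cap X^\perp$. *)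

theory Defs
  imports Complex_Main "HOL-Library.Z2" "HOL-Algebra.Group_Action"
begin

datatype letter = A | B | C | D | E | F | G | H

text \<open>Only the qualified names \<open>letter.A\<close>, ..., \<open>letter.H\<close> stay accessible,
  so that the capital letters remain usable as variables.\<close>

hide_const (open) A B C D E F G H

lemma UNIV_letter:
  "(UNIV :: letter set) = {letter.A, letter.B, letter.C, letter.D, letter.E, letter.F, letter.G, letter.H}"
  using letter.exhaust by auto

instance letter :: finite
  by standard (simp add: UNIV_letter)

lemma card_letter: "card (UNIV :: letter set) = 8"
  by (simp add: UNIV_letter)

lemma even_card_Compl: "even (card (- I)) \<longleftrightarrow> even (card I)" for I :: "letter set"
proof -
  have "card I + card (- I) = card (I \<union> - I)"
    by (rule card_Un_disjoint [symmetric]) auto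
  also have "\<dots> = 8" by (simp add: card_letter)
  finally show ?thesis by presburger
qed

lemma even_card_sym_diff:
  "even (card (sym_diff I J)) \<longleftrightarrow> (even (card I) \<longleftrightarrow> even (card J))" for I J :: "letter set"
proof -
  have 1: "card (sym_diff I J) = card (I - J) + card (J - I)"
    by (rule card_Un_disjoint) auto
  have 2: "card I = card (I - J) + card (I \<inter> J)"
    by (subst card_Un_disjoint [symmetric]) (auto intro: arg_cong [where f = card])
  have 3: "card J = card (J - I) + card (I \<inter> J)"
    by (subst card_Un_disjoint [symmetric]) (auto intro: arg_cong [where f = card])
  show ?thesis using 1 2 3 by presburger
qed

lemma even_card_Int_Compl:
  fixes I J :: "letter set"
  assumes "even (card I)"
  shows "even (card (I \<inter> - J)) \<longleftrightarrow> even (card (I \<inter> J))"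
proof -
  have "card I = card (I \<inter> - J) + card (I \<inter> J)"
    by (subst card_Un_disjoint [symmetric]) (auto intro: arg_cong [where f = card])
  then show ?thesis using assms by presburger
qed

lemma of_nat_bit_eq_iff: "(of_nat m :: bit) = of_nat n \<longleftrightarrow> (even m \<longleftrightarrow> even n)"
  by (cases "even m"; cases "even n") (auto simp: of_nat_eq_1_iff elim!: evenE oddE)

definition e3_rel :: "letter set \<Rightarrow> letter set \<Rightarrow> bool" where
  "e3_rel I J \<longleftrightarrow> even (card I) \<and> even (card J) \<and> (J = I \<or> J = - I)"

quotient_type e3 = "letter set" / partial: e3_rel
proof (rule part_equivpI)
  show "\<exists>x. e3_rel x x" by (rule exI [of _ "{}"]) (simp add: e3_rel_def)
  show "symp e3_rel" by (rule sympI) (auto simp: e3_rel_def)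
  show "transp e3_rel" by (rule transpI) (auto simp: e3_rel_def)
qed

instantiation e3 :: ab_group_add
begin

lift_definition zero_e3 :: e3 is "{}"
  by (simp add: e3_rel_def)

lift_definition plus_e3 :: "e3 \<Rightarrow> e3 \<Rightarrow> e3" is "\<lambda>I J. sym_diff I J"
  by (auto simp: e3_rel_def even_card_sym_diff even_card_Compl)

text \<open>Every element is its own negative.\<close>

definition uminus_e3 :: "e3 \<Rightarrow> e3" where "- x = (x :: e3)"

definition minus_e3 :: "e3 \<Rightarrow> e3 \<Rightarrow> e3" where "x - y = x + (y :: e3)"

instance
proof
  fix x y z :: e3
  show "x + y + z = x + (y + z)"
    by transfer (auto simp: e3_rel_def even_card_sym_diff)
  show "x + y = y + x"
    by transfer (auto simp: e3_rel_def even_card_sym_diff)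
  show "0 + x = x"
    by transfer (auto simp: e3_rel_def)
  show "- x + x = 0"
    unfolding uminus_e3_def by transfer (auto simp: e3_rel_def)
  show "x - y = x + - y"
    by (simp add: minus_e3_def uminus_e3_def)
qed

end

lemma e3_add_self: "x + x = (0 :: e3)"
  using left_minus [of x] by (simp add: uminus_e3_def)

definition scale_e3 :: "bit \<Rightarrow> e3 \<Rightarrow> e3" where
  "scale_e3 c x = (if c = 0 then 0 else x)"

global_interpretation e3: vector_space scale_e3
proof
  fix a b :: bit and x y :: e3
  show "scale_e3 a (x + y) = scale_e3 a x + scale_e3 a y"
    by (simp add: scale_e3_def)
  show "scale_e3 (a + b) x = scale_e3 a x + scale_e3 b x"
    by (cases a; cases b) (simp_all add: scale_e3_def e3_add_self)
  show "scale_e3 a (scale_e3 b x) = scale_e3 (a * b) x"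
    by (simp add: scale_e3_def)
  show "scale_e3 1 x = x"
    by (simp add: scale_e3_def)
qed

lift_definition pairing :: "e3 \<Rightarrow> e3 \<Rightarrow> bit" is "\<lambda>I J. of_nat (card (I \<inter> J))"
  unfolding e3_rel_def of_nat_bit_eq_iff
  by (metis even_card_Compl even_card_Int_Compl inf_commute)

definition perp :: "e3 set \<Rightarrow> e3 set" where
  "perp X = {y. \<forall>x\<in>X. pairing x y = 0}"

definition isotropic :: "e3 set \<Rightarrow> bool" where
  "isotropic X \<longleftrightarrow> (\<forall>x\<in>X. \<forall>y\<in>X. pairing x y = 0)"

definition Sp62 :: "(e3 \<Rightarrow> e3) monoid" where
  "Sp62 = \<lparr>carrier = {f. Vector_Spaces.linear scale_e3 scale_e3 f \<and> bij f \<and>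
                         (\<forall>x y. pairing (f x) (f y) = pairing x y)},
           mult = (\<circ>), one = id\<rparr>"

text \<open>
  The order inside a pair \<open>(X, X\<^sup>\<bottom>)\<close> is determined by the dimensions, except when both
  are 3, where it is immaterial. A collection is therefore a set of unordered pairs
  \<open>{X, X\<^sup>\<bottom>}\<close>, and \<open>ordered_pairs\<close> lists all admissible orderings of its members:
  one for each pair of unequal dimensions, both for each pair of two distinct
  3-dimensional subspaces.
\<close>

definition ordered_pairs :: "e3 set set set \<Rightarrow> (e3 set \<times> e3 set) set" where
  "ordered_pairs L =
     {(X, perp X) | X. e3.subspace X \<and> e3.dim X \<le> e3.dim (perp X) \<and> {X, perp X} \<in> L}"

definition compatible :: "e3 set set set \<Rightarrow> bool" where
  "compatible L \<longleftrightarrow>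
     (\<forall>p\<in>L. \<exists>X. e3.subspace X \<and> p = {X, perp X}) \<and>
     ({0}, UNIV) \<in> ordered_pairs L \<and>
     (\<forall>(X, X')\<in>ordered_pairs L. e3.dim X \<le> 1 \<or> \<not> isotropic X) \<and>
     (\<forall>(X, X')\<in>ordered_pairs L. \<forall>(Y, Y')\<in>ordered_pairs L.
        {X, X'} \<noteq> {Y, Y'} \<longrightarrow> X \<subseteq> Y \<or> Y \<subseteq> X \<or> X \<subseteq> Y') \<and>
     (\<forall>(X, X')\<in>ordered_pairs L - {({0}, UNIV)}. \<forall>(Y, Y')\<in>ordered_pairs L - {({0}, UNIV)}.
        {X, X'} \<noteq> {Y, Y'} \<longrightarrow> \<not> X \<subseteq> Y \<inter> Y' \<and> \<not> Y \<subseteq> X \<inter> X')"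

definition act :: "(e3 \<Rightarrow> e3) \<Rightarrow> e3 set set set \<Rightarrow> e3 set set set" where
  "act f L = (\<lambda>p. (\<lambda>X. f ` X) ` p) ` L"

lemma Sp62_group: "group Sp62"
proof (rule groupI)
  show "\<one>\<^bsub>Sp62\<^esub> \<in> carrier Sp62"
    by (simp add: Sp62_def e3.linear_id)
next
  fix f g assume "f \<in> carrier Sp62" "g \<in> carrier Sp62"
  then show "f \<otimes>\<^bsub>Sp62\<^esub> g \<in> carrier Sp62"
    by (auto simp: Sp62_def bij_comp intro: Vector_Spaces.linear_compose)
next
  fix f assume f: "f \<in> carrier Sp62"
  then interpret Vector_Spaces.linear scale_e3 scale_e3 f by (simp add: Sp62_def)
  have "bij f" using f by (simp add: Sp62_def)
  then have inv: "f (Hilbert_Choice.inv f x) = x" "Hilbert_Choice.inv f (f x) = x" for x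
    by (simp_all add: bij_is_surj surj_f_inv_f bij_is_inj)
  have "Vector_Spaces.linear scale_e3 scale_e3 (Hilbert_Choice.inv f)"
    by unfold_locales (metis inv add, metis inv scale)
  moreover have "pairing (Hilbert_Choice.inv f x) (Hilbert_Choice.inv f y) = pairing x y" for x y
    using f inv by (simp add: Sp62_def) metis
  ultimately have "Hilbert_Choice.inv f \<in> carrier Sp62"
    using \<open>bij f\<close> by (simp add: Sp62_def bij_imp_bij_inv)
  moreover have "Hilbert_Choice.inv f \<otimes>\<^bsub>Sp62\<^esub> f = \<one>\<^bsub>Sp62\<^esub>"
    using inv by (auto simp: Sp62_def)
  ultimately show "\<exists>g\<in>carrier Sp62. g \<otimes>\<^bsub>Sp62\<^esub> f = \<one>\<^bsub>Sp62\<^esub>" by blast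
qed (auto simp: Sp62_def comp_assoc)

text \<open>\<open>act\<close> is an action on all sets of sets of subsets of \<open>e3\<close>; the orbits of interest
  are those of the compatible collections.\<close>

lemma Sp62_group_action: "group_action Sp62 UNIV act"
proof -
  have bij: "bij (act f)" if "f \<in> carrier Sp62" for f
  proof -
    have "bij f" using that by (simp add: Sp62_def)
    then have "bij ((`) ((`) ((`) f)))"
      by (metis bij_betw_Pow Pow_UNIV)
    then show ?thesis by (simp add: act_def [abs_def])
  qed
  then have "act \<in> hom Sp62 (BijGroup UNIV)"
    by (auto simp: hom_def BijGroup_def Bij_def compose_def act_def Sp62_def image_image fun_eq_iff)
  then show ?thesis
    by (simp add: group_action_def group_hom_def group_hom_axioms_def Sp62_group group_BijGroup)
qed

end

theory Submission
  imports Defs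
begin

text \<open>
  A compatible collection is a finite combinatorial object. Its nonzero small members (those of
  dimension at most \<open>3\<close>) are points \<open>{0, v}\<close>, hyperbolic planes, and at most one pair
  \<open>T\<close>, \<open>T\<^sup>\<bottom>\<close> of nonisotropic subspaces of dimension \<open>3\<close>. A subspace \<open>T\<close> of the last kind is
  a cone: it is spanned by a hyperbolic plane and its radical \<open>T \<inter> T\<^sup>\<bottom> = {0, v}\<close>. Between these
  members the axioms reduce to
  orthogonality: points are pairwise orthogonal, distinct planes are orthogonal, each point
  lies in each plane or in its complement, points and planes lie in \<open>T\<close> or in \<open>T\<^sup>\<bottom>\<close>, and
  \<open>v\<close> is not one of the points. This is the predicate \<open>configuration\<close>, and lemmas
  \<open>compatible_configuration\<close> and \<open>configuration_compatible\<close> translate in both directions.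

  Every configuration is one of \<open>43\<close> standard triples (points, planes, cones) written in a
  suitable symplectic basis \<open>a\<^sub>1, b\<^sub>1, a\<^sub>2, b\<^sub>2, a\<^sub>3, b\<^sub>3\<close>
  (\<open>configuration_normalizable\<close>):
  \<^item> without planes and cones, the points are a subset of the Fano plane of a Lagrangian
    subspace, and the Fano plane has \<open>10\<close> subsets up to collineation;
  \<^item> with one plane \<open>P\<close>, there is at most one point in \<open>P\<close>, and \<open>P\<^sup>\<bottom>\<close> contains \<open>0\<close>, \<open>1\<close>, \<open>2\<close> or
    all \<open>3\<close> points of an isotropic line, which gives \<open>2 \<cdot> 4 = 8\<close> forms;
  \<^item> with two planes, each of them and their common complement contain at most one point, and
    the two planes are interchangeable, which gives \<open>3 \<cdot> 2 = 6\<close> forms;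
  \<^item> with three planes, which are interchangeable, there are \<open>4\<close> forms;
  \<^item> with cones, each of the two contains one of \<open>5\<close> standard pieces: nothing, a point, two
    points \<open>a\<close> and \<open>a + v\<close>, a plane, or a plane with a point in it. The cones are interchangeable,
    which gives \<open>15\<close> forms.

  The group acts transitively on symplectic bases (\<open>Sp62_transitive\<close>), so each standard triple
  gives one orbit, whatever basis is used. The orbits are distinct because a few
  cardinalities and the existence of a line of points, collected in \<open>signature\<close>, are
  invariant and separate the \<open>43\<close> triples (\<open>distinct_signatures\<close>).
\<close>

section \<open>The symplectic space\<close>

lemma e3_add_self_left: "x + (x + y) = (y :: e3)"
  by (simp add: e3_add_self flip: add.assoc)

lemma e3_uminus [simp]: "- x = (x :: e3)"
  by (simp add: uminus_e3_def)

lemma e3_minus [simp]: "x - y = x + (y :: e3)"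
  by (simp add: minus_e3_def)

lemmas e3_simps = e3_add_self e3_add_self_left add_eq_0_iff add.assoc add.commute add.left_commute

lemma e3_add_eq_iff: "x + y = z \<longleftrightarrow> y = x + (z :: e3)"
  by (metis e3_add_self_left)

lemma bit_neq_0 [simp]: "(c :: bit) \<noteq> 0 \<longleftrightarrow> c = 1"
  by (cases c) auto

lemma ex_bit: "(\<exists>c :: bit. P c) \<longleftrightarrow> P 0 \<or> P 1"
  by (metis bit_not_one_iff)

lemma e3_subspace_iff: "e3.subspace X \<longleftrightarrow> 0 \<in> X \<and> (\<forall>x\<in>X. \<forall>y\<in>X. x + y \<in> X)"
  by (auto simp: e3.subspace_def scale_e3_def)

lemma e3_linear_iff:
  "Vector_Spaces.linear scale_e3 scale_e3 f \<longleftrightarrow> (\<forall>x y. f (x + y) = f x + f y)"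
proof
  assume "\<forall>x y. f (x + y) = f x + f y"
  moreover from this have "f 0 = 0"
    by (metis add_cancel_right_right)
  ultimately show "Vector_Spaces.linear scale_e3 scale_e3 f"
    by unfold_locales (auto simp: scale_e3_def)
qed (metis Vector_Spaces.linear_iff)

lemma pairing_commute: "pairing x y = pairing y x"
  by transfer (simp add: Int_commute)

lemma pairing_add_right: "pairing x (y + z) = pairing x y + pairing x z"
proof transfer
  fix I J K :: "letter set"
  have "I \<inter> sym_diff J K = sym_diff (I \<inter> J) (I \<inter> K)" by blast
  then have "even (card (I \<inter> sym_diff J K)) \<longleftrightarrow> (even (card (I \<inter> J)) \<longleftrightarrow> even (card (I \<inter> K)))"
    by (simp only: even_card_sym_diff)
  then show "of_nat (card (I \<inter> sym_diff J K)) = (of_nat (card (I \<inter> J)) + of_nat (card (I \<inter> K)) :: bit)"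
    unfolding of_nat_add [symmetric] of_nat_bit_eq_iff by simp
qed

lemma pairing_add_left: "pairing (x + y) z = pairing x z + pairing y z"
  by (metis pairing_add_right pairing_commute)

lemma pairing_self [simp]: "pairing x x = 0"
  by transfer (auto simp: e3_rel_def of_nat_bit_eq_iff [where n = 0, simplified])

lemma pairing_0 [simp]: "pairing 0 x = 0" "pairing x 0 = 0"
  using pairing_add_left [of x x x] pairing_add_right [of x x x] by (simp_all add: e3_add_self)

lemma pairing_nondegenerate:
  assumes "x \<noteq> 0"
  obtains y where "pairing x y = 1"
proof -
  have "x \<noteq> 0 \<longrightarrow> (\<exists>y. pairing x y = 1)"
  proof (transfer, rule impI)
    fix I :: "letter set"
    assume I: "e3_rel I I" and nz: "\<not> e3_rel I {}"
    from nz I have "I \<noteq> {}" "I \<noteq> UNIV" by (auto simp: e3_rel_def)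
    then obtain a b where "a \<in> I" "b \<notin> I" by auto
    then have "e3_rel {a, b} {a, b}" "I \<inter> {a, b} = {a}"
      by (auto simp: e3_rel_def card_insert_if)
    then show "\<exists>J\<in>{J. e3_rel J J}. of_nat (card (I \<inter> J)) = (1 :: bit)"
      by (intro bexI [of _ "{a, b}"]) simp_all
  qed
  then show ?thesis using assms that by blast
qed

text \<open>Each class has a unique representative that avoids \<open>letter.H\<close>, and its even
  cardinality decides whether it contains \<open>letter.G\<close>; the other six letters are free.\<close>

lemma card_UNIV_e3: "card (UNIV :: e3 set) = 64"
proof -
  let ?D = "- {letter.G, letter.H}"
  \<comment> \<open>The even set avoiding \<open>letter.H\<close> whose trace on the six free letters is \<open>K\<close>.\<close>
  define ev where "ev K = (if even (card K) then K else insert letter.G K)" for K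
  have ev_even: "even (card (ev K))" if "K \<subseteq> ?D" for K
    using that by (auto simp: ev_def card_insert_if)
  have ev_H: "letter.H \<notin> ev K" if "K \<subseteq> ?D" for K
    using that by (auto simp: ev_def)
  have "bij_betw (\<lambda>K. abs_e3 (ev K)) (Pow ?D) UNIV"
  proof (rule bij_betwI')
    fix K K' assume K: "K \<in> Pow ?D" "K' \<in> Pow ?D"
    show "abs_e3 (ev K) = abs_e3 (ev K') \<longleftrightarrow> K = K'"
    proof
      assume "abs_e3 (ev K) = abs_e3 (ev K')"
      then have "e3_rel (ev K) (ev K')"
        using ev_even K by (subst Quotient3_rel [OF Quotient3_e3, symmetric]) (auto simp: e3_rel_def)
      then have "ev K' = ev K"
        using ev_H [of K] ev_H [of K'] K unfolding e3_rel_def by blast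
      then have "ev K' - {letter.G} = ev K - {letter.G}" by simp
      then show "K = K'" using K by (auto simp: ev_def split: if_splits)
    qed simp
  next
    fix y :: e3
    obtain I where I: "even (card I)" "y = abs_e3 I"
      by (metis Quotient3_abs_rep [OF Quotient3_e3] Quotient3_rep_reflp [OF Quotient3_e3] e3_rel_def)
    define I' where "I' = (if letter.H \<in> I then - I else I)"
    have "letter.H \<notin> I'" by (auto simp: I'_def)
    have I': "even (card I')" "y = abs_e3 I'"
    proof -
      show "even (card I')" using I by (simp add: I'_def even_card_Compl)
      have "e3_rel I I'" using I by (simp add: I'_def e3_rel_def even_card_Compl)
      from Quotient3_rel_abs [OF Quotient3_e3 this] show "y = abs_e3 I'"
        using I(2) by (rule trans [rotated])
    qed
    have "ev (I' - {letter.G}) = I'"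
    proof (cases "letter.G \<in> I'")
      case True
      then have "card I' = Suc (card (I' - {letter.G}))"
        by (simp only: card.remove [OF finite])
      then show ?thesis using I'(1) True by (auto simp: ev_def)
    next
      case False
      then show ?thesis using I'(1) by (simp add: ev_def)
    qed
    moreover have "I' - {letter.G} \<in> Pow ?D" using \<open>letter.H \<notin> I'\<close> by auto
    ultimately show "\<exists>K\<in>Pow ?D. y = abs_e3 (ev K)" using I'(2) by (intro bexI [of _ "I' - {letter.G}"]) simp_all
  qed auto
  then have "card (UNIV :: e3 set) = card (Pow ?D)"
    by (metis bij_betw_same_card)
  also have "\<dots> = 2 ^ card ?D" by (simp add: card_Pow)
  also have "card ?D = 6" using card_Diff_subset [of "{letter.G, letter.H}" UNIV] by (simp add: card_letter Compl_eq_Diff_UNIV)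
  finally show ?thesis by simp
qed

instance e3 :: finite
  by standard (metis card_UNIV_e3 card.infinite zero_neq_numeral)

lemma finite_e3 [simp]: "finite (X :: e3 set)" by simp

lemma e3_card_dim: 
  assumes "e3.subspace X"
  shows "card X = 2 ^ e3.dim X"
proof -
  have span: "card (e3.span B) = 2 ^ card B" if "e3.independent B" for B
    using finite [of B] that
  proof (induction B rule: finite_induct)
    case empty
    then show ?case by simp
  next
    case (insert b B)
    have b: "b \<notin> e3.span B" "e3.independent B"
      using insert by (auto simp: e3.independent_insert)
    have "e3.span (insert b B) = e3.span B \<union> (+) b ` e3.span B"
    proof (rule Set.set_eqI)
      fix x
      have "x \<in> e3.span (insert b B) \<longleftrightarrow> (\<exists>k. x - scale_e3 k b \<in> e3.span B)"
        by (simp add: e3.span_insert)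
      also have "\<dots> \<longleftrightarrow> x \<in> e3.span B \<or> b + x \<in> e3.span B"
        by (simp add: ex_bit scale_e3_def add.commute [of x])
      also have "\<dots> \<longleftrightarrow> x \<in> e3.span B \<union> (+) b ` e3.span B"
        by (metis (no_types, lifting) Un_iff image_iff e3_add_self_left)
      finally show "x \<in> e3.span (insert b B) \<longleftrightarrow> x \<in> e3.span B \<union> (+) b ` e3.span B" .
    qed
    moreover have "e3.span B \<inter> (+) b ` e3.span B = {}"
    proof -
      have False if "x \<in> e3.span B" "b + x \<in> e3.span B" for x
        using e3.span_add [OF that] b by (simp add: e3_simps)
      then show ?thesis by blast
    qed
    ultimately have "card (e3.span (insert b B)) = card (e3.span B) + card ((+) b ` e3.span B)"
      by (simp add: card_Un_disjoint)
    also have "card ((+) b ` e3.span B) = card (e3.span B)"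
      by (rule card_image) simp
    finally show ?case using insert b by simp
  qed
  obtain B where "B \<subseteq> X" "e3.independent B" "X \<subseteq> e3.span B" "card B = e3.dim X"
    using e3.basis_exists by blast
  moreover have "e3.span B \<subseteq> X"
    using assms \<open>B \<subseteq> X\<close> by (rule e3.span_minimal [rotated])
  ultimately show ?thesis using span by (metis subset_antisym)
qed

lemma subspace_perp [simp]: "e3.subspace (perp X)"
  by (simp add: e3_subspace_iff perp_def pairing_add_right)

lemma subset_perp_commute: "X \<subseteq> perp Y \<longleftrightarrow> Y \<subseteq> perp X"
  using pairing_commute by (fastforce simp: perp_def subset_iff)

text \<open>Count the double sum of the signs \<open>(-1)\<^bsup>\<langle>x, y\<rangle>\<^esup>\<close> over \<open>x \<in> X\<close> and all \<open>y\<close> in both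
  orders: summing over \<open>y\<close> first only \<open>x = 0\<close> contributes, summing over \<open>x\<close> first only
  \<open>y \<in> X\<^sup>\<bottom>\<close> does.\<close>

lemma card_perp:
  assumes X: "e3.subspace X"
  shows "card X * card (perp X) = 64"
proof -
  define s :: "e3 \<Rightarrow> e3 \<Rightarrow> int" where "s x y = (if pairing x y = 0 then 1 else - 1)" for x y
  have s_add: "s (x + y) z = s x z * s y z" for x y z
    by (cases "pairing x z"; cases "pairing y z") (auto simp: s_def pairing_add_left)
  have s_commute: "s x y = s y x" for x y
    by (simp add: s_def pairing_commute)
  have sum0: "(\<Sum>x\<in>Y. s x y) = 0" if Y: "e3.subspace Y" and z: "z \<in> Y" "pairing z y = 1" for Y y z
  proof -
    have "(\<Sum>x\<in>Y. s x y) = (\<Sum>x\<in>Y. s (z + x) y)"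
      by (rule sum.reindex_bij_witness [where i = "(+) z" and j = "(+) z"])
        (use Y z in \<open>auto simp: e3_add_self_left e3_subspace_iff\<close>)
    also have "\<dots> = - (\<Sum>x\<in>Y. s x y)"
      using z by (simp add: s_add sum_negf) (simp add: s_def sum_negf)
    finally show ?thesis by simp
  qed
  have "(\<Sum>x\<in>X. \<Sum>y\<in>UNIV. s x y) = (\<Sum>x\<in>X. if x = 0 then 64 else 0)"
  proof (rule sum.cong)
    fix x assume "x \<in> X"
    show "(\<Sum>y\<in>UNIV. s x y) = (if x = 0 then 64 else 0)"
    proof (cases "x = 0")
      case True
      then show ?thesis by (simp add: s_def card_UNIV_e3)
    next
      case False
      then obtain z where "pairing x z = 1" by (rule pairing_nondegenerate)
      then show ?thesis using sum0 [of UNIV z x] False by (simp add: s_commute [of x] pairing_commute)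
    qed
  qed simp
  also have "\<dots> = 64" using X by (simp add: sum.delta e3_subspace_iff)
  finally have 1: "(\<Sum>x\<in>X. \<Sum>y\<in>UNIV. s x y) = 64" .
  have "(\<Sum>y\<in>UNIV. \<Sum>x\<in>X. s x y) = (\<Sum>y\<in>UNIV. if y \<in> perp X then int (card X) else 0)"
  proof (rule sum.cong)
    fix y :: e3
    show "(\<Sum>x\<in>X. s x y) = (if y \<in> perp X then int (card X) else 0)"
    proof (cases "y \<in> perp X")
      case True
      then show ?thesis by (simp add: s_def perp_def)
    next
      case False
      then obtain z where "z \<in> X" "pairing z y = 1" by (auto simp: perp_def)
      then show ?thesis using sum0 X False by simp
    qed
  qed simp
  also have "\<dots> = int (card X * card (perp X))"
    by (simp add: sum.If_cases)
  finally have "int (card X * card (perp X)) = 64"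
    using 1 by (simp add: sum.swap [of _ X UNIV])
  then show ?thesis by linarith
qed

lemma perp_perp:
  assumes X: "e3.subspace X"
  shows "perp (perp X) = X"
proof -
  have "X \<subseteq> perp (perp X)" by (subst subset_perp_commute) simp
  moreover have "card (perp (perp X)) = card X"
  proof -
    have "card (perp X) * card (perp (perp X)) = card (perp X) * card X"
      using card_perp [OF X] card_perp [OF subspace_perp, of X] by (simp add: mult.commute)
    moreover have "card (perp X) \<noteq> 0" using card_perp [OF X] by (metis mult_0_right zero_neq_numeral)
    ultimately show ?thesis by simp
  qed
  ultimately show ?thesis by (metis card_subset_eq finite_e3)
qed

lemma dim_le_dim_perp_iff:
  assumes X: "e3.subspace X"
  shows "e3.dim X \<le> e3.dim (perp X) \<longleftrightarrow> card X \<le> 8"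
proof -
  have "e3.dim X \<le> e3.dim (perp X) \<longleftrightarrow> card X \<le> card (perp X)"
    using X by (simp add: e3_card_dim)
  also have "\<dots> \<longleftrightarrow> card X \<le> 8"
  proof
    assume "card X \<le> card (perp X)"
    then have "card X * card X \<le> 64"
      using card_perp [OF X] by (metis mult_le_mono2)
    then show "card X \<le> 8"
      using mult_le_mono [of 9 "card X" 9 "card X"] by linarith
  next
    assume 8: "card X \<le> 8"
    then have "8 * card (perp X) \<ge> 64"
      using card_perp [OF X] by (metis mult_le_mono1)
    then show "card X \<le> card (perp X)" using 8 by linarith
  qed
  finally show ?thesis .
qed

lemma dim_le_1_iff:
  assumes X: "e3.subspace X"
  shows "e3.dim X \<le> 1 \<longleftrightarrow> card X \<le> 2"
proof -
  have "card X \<le> 2 \<longleftrightarrow> (2::nat) ^ e3.dim X \<le> 2 ^ 1" by (simp add: e3_card_dim [OF X])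
  also have "\<dots> \<longleftrightarrow> e3.dim X \<le> 1" by (rule power_increasing_iff) simp
  finally show ?thesis by simp
qed

section \<open>Symplectic bases\<close>

definition span2 :: "e3 \<Rightarrow> e3 \<Rightarrow> e3 set" where
  "span2 x y = {0, x, y, x + y}"

definition span3 :: "e3 \<Rightarrow> e3 \<Rightarrow> e3 \<Rightarrow> e3 set" where
  "span3 x y z = span2 x y \<union> (+) z ` span2 x y"

lemma span3_eq: "span3 x y z = {0, x, y, x + y, z, x + z, y + z, x + (y + z)}"
  by (auto simp: span3_def span2_def e3_simps)

lemma subspace_span2 [simp]: "e3.subspace (span2 x y)"
  by (auto simp: e3_subspace_iff span2_def e3_simps)

lemma subspace_span3 [simp]: "e3.subspace (span3 x y z)"
  by (auto simp: e3_subspace_iff span3_eq e3_simps)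

lemma span2_subset: "e3.subspace X \<Longrightarrow> x \<in> X \<Longrightarrow> y \<in> X \<Longrightarrow> span2 x y \<subseteq> X"
  by (auto simp: e3_subspace_iff span2_def)

lemma span3_subset: "e3.subspace X \<Longrightarrow> x \<in> X \<Longrightarrow> y \<in> X \<Longrightarrow> z \<in> X \<Longrightarrow> span3 x y z \<subseteq> X"
  by (auto simp: e3_subspace_iff span3_eq)

lemma card_span2: "x \<noteq> 0 \<Longrightarrow> y \<noteq> 0 \<Longrightarrow> x \<noteq> y \<Longrightarrow> card (span2 x y) = 4"
  by (auto simp: span2_def card_insert_if e3_simps)

lemma perp_iff_pairing: "w \<in> perp X \<longleftrightarrow> (\<forall>x\<in>X. pairing w x = 0)"
  by (simp add: perp_def pairing_commute)

lemma perp_span2: "w \<in> perp (span2 x y) \<longleftrightarrow> pairing x w = 0 \<and> pairing y w = 0"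
  by (auto simp: perp_def span2_def pairing_add_left)

lemma perp_span3: "w \<in> perp (span3 x y z) \<longleftrightarrow> pairing x w = 0 \<and> pairing y w = 0 \<and> pairing z w = 0"
  by (auto simp: perp_def span3_eq pairing_add_left)

text \<open>The pairing identifies the space with its dual, so a vector outside a subspace is
  detected by a functional \<open>\<langle>_, z\<rangle>\<close> that vanishes on the subspace.\<close>

lemma dual_vector:
  assumes "e3.subspace X" "x \<notin> X"
  obtains z where "z \<in> perp X" "pairing x z = 1"
proof -
  have "x \<notin> perp (perp X)" using assms perp_perp by blast
  then show ?thesis using that by (auto simp: perp_iff_pairing)
qed

text \<open>Equivalently, \<open>x, y, z\<close> is a basis of a Lagrangian subspace: the inequalities exclude exactly the
  seven nontrivial linear relations.\<close>

definition isotropic_triple :: "e3 \<Rightarrow> e3 \<Rightarrow> e3 \<Rightarrow> bool" where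
  "isotropic_triple x y z \<longleftrightarrow> pairing x y = 0 \<and> pairing x z = 0 \<and> pairing y z = 0 \<and>
     x \<noteq> 0 \<and> y \<noteq> 0 \<and> z \<noteq> 0 \<and> x \<noteq> y \<and> x \<noteq> z \<and> y \<noteq> z \<and> x + y \<noteq> z"

lemma isotropic_triple_rotate: "isotropic_triple x y z \<Longrightarrow> isotropic_triple y z x"
  by (auto simp: isotropic_triple_def pairing_commute e3_add_eq_iff e3_simps)

lemma card_span3:
  assumes "x \<noteq> 0" "y \<noteq> 0" "z \<noteq> 0" "x \<noteq> y" "x \<noteq> z" "y \<noteq> z" "x + y \<noteq> z"
  shows "card (span3 x y z) = 8"
proof -
  have "distinct [0, x, y, x + y, z, x + z, y + z, x + (y + z)]"
    using assms by (auto simp: e3_simps e3_add_eq_iff)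
  then show ?thesis
    using distinct_card [of "[0, x, y, x + y, z, x + z, y + z, x + (y + z)]"]
    by (simp only: span3_eq list.set) simp
qed

text \<open>The span of the triple has order \<open>8 = 64 / 8\<close>, so it equals its own orthogonal complement.\<close>

lemma isotropic_triple_maximal:
  assumes "isotropic_triple x y z" "pairing x w = 0" "pairing y w = 0" "pairing z w = 0"
  shows "w \<in> span3 x y z"
proof -
  have card: "card (span3 x y z) = 8"
    using assms(1) by (simp add: isotropic_triple_def card_span3)
  then have "card (perp (span3 x y z)) = 8"
    using card_perp [OF subspace_span3, of x y z] by simp
  moreover have "span3 x y z \<subseteq> perp (span3 x y z)"
    by (rule span3_subset) (use assms(1) in \<open>auto simp: isotropic_triple_def perp_span3 pairing_commute\<close>)
  ultimately have "span3 x y z = perp (span3 x y z)"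
    using card by (intro card_subset_eq) auto
  then show ?thesis using assms perp_span3 by blast
qed

definition symplectic_basis :: "e3 \<Rightarrow> e3 \<Rightarrow> e3 \<Rightarrow> e3 \<Rightarrow> e3 \<Rightarrow> e3 \<Rightarrow> bool" where
  "symplectic_basis a1 b1 a2 b2 a3 b3 \<longleftrightarrow>
     pairing a1 b1 = 1 \<and> pairing a2 b2 = 1 \<and> pairing a3 b3 = 1 \<and>
     pairing a1 a2 = 0 \<and> pairing a1 b2 = 0 \<and> pairing a1 a3 = 0 \<and> pairing a1 b3 = 0 \<and>
     pairing b1 a2 = 0 \<and> pairing b1 b2 = 0 \<and> pairing b1 a3 = 0 \<and> pairing b1 b3 = 0 \<and>
     pairing a2 a3 = 0 \<and> pairing a2 b3 = 0 \<and> pairing b2 a3 = 0 \<and> pairing b2 b3 = 0"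

lemma symplectic_basis_swap12:
  "symplectic_basis a1 b1 a2 b2 a3 b3 \<Longrightarrow> symplectic_basis a2 b2 a1 b1 a3 b3"
  by (auto simp: symplectic_basis_def pairing_commute)

lemma symplectic_basis_isotropic_triple:
  assumes "symplectic_basis a1 b1 a2 b2 a3 b3"
  shows "isotropic_triple a1 a2 a3"
proof -
  have "x \<noteq> 0" if "pairing x y = 1" for x y
    using that by auto
  moreover have "x \<noteq> y" if "pairing x z = 1" "pairing z y = 0" for x y z
    using that by (auto simp: pairing_commute)
  moreover have "a1 + a2 \<noteq> a3"
    using assms by (auto simp: symplectic_basis_def pairing_add_left)
  ultimately show ?thesis
    using assms unfolding symplectic_basis_def isotropic_triple_def by (metis pairing_commute)
qed

lemma pairing_scale_left: "pairing (scale_e3 c x) y = c * pairing x y"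
  by (cases c) (auto simp: scale_e3_def)

lemma pairing_scale_right: "pairing x (scale_e3 c y) = c * pairing x y"
  by (cases c) (auto simp: scale_e3_def)

lemmas pairing_linear = pairing_add_left pairing_add_right pairing_scale_left pairing_scale_right

lemma isotropic_triple_dual:
  assumes "isotropic_triple x y z"
  obtains w where "pairing x w = 1" "pairing y w = 0" "pairing z w = 0"
proof -
  have "x \<notin> span2 y z"
    using assms by (auto simp: isotropic_triple_def span2_def e3_simps)
  then show ?thesis using dual_vector [of "span2 y z" x] that by (auto simp: perp_span2)
qed

text \<open>A vector dual to \<open>a\<^sub>i\<close> inside an isotropic triple is made orthogonal to a dual vector
  \<open>b\<^sub>j\<close> that is already chosen by adding a multiple of \<open>a\<^sub>j\<close>; this does not
  change its pairings with the triple. The three extension lemmas differ in how many dual vectors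
  are prescribed.\<close>

lemma extend_b3:
  assumes a: "isotropic_triple a1 a2 a3"
    and b: "pairing a1 b1 = 1" "pairing a2 b1 = 0" "pairing a3 b1 = 0"
      "pairing a1 b2 = 0" "pairing a2 b2 = 1" "pairing a3 b2 = 0" "pairing b1 b2 = 0"
  shows "\<exists>b3. symplectic_basis a1 b1 a2 b2 a3 b3"
proof -
  obtain z where z: "pairing a3 z = 1" "pairing a1 z = 0" "pairing a2 z = 0"
    using isotropic_triple_rotate isotropic_triple_dual a by metis
  define b3 where "b3 = z + scale_e3 (pairing b1 z) a1 + scale_e3 (pairing b2 z) a2"
  have "pairing b1 a1 = 1" "pairing b1 a2 = 0" "pairing b1 a3 = 0"
      "pairing b2 a1 = 0" "pairing b2 a2 = 1" "pairing b2 a3 = 0" "pairing a2 a1 = 0"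
      "pairing a3 a1 = 0" "pairing a3 a2 = 0"
    using a b by (simp_all add: pairing_commute isotropic_triple_def)
  then show ?thesis
    using a b z by (intro exI [of _ b3])
      (simp add: b3_def symplectic_basis_def isotropic_triple_def pairing_linear)
qed

lemma extend_b2_b3:
  assumes a: "isotropic_triple a1 a2 a3"
    and b: "pairing a1 b1 = 1" "pairing a2 b1 = 0" "pairing a3 b1 = 0"
  shows "\<exists>b2 b3. symplectic_basis a1 b1 a2 b2 a3 b3"
proof -
  obtain z where z: "pairing a2 z = 1" "pairing a3 z = 0" "pairing a1 z = 0"
    using isotropic_triple_rotate isotropic_triple_dual a by metis
  define b2 where "b2 = z + scale_e3 (pairing b1 z) a1"
  have "pairing b1 a1 = 1" "pairing b1 a2 = 0" "pairing b1 a3 = 0" "pairing a2 a1 = 0"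
      "pairing a3 a1 = 0" "pairing a3 a2 = 0"
    using a b by (simp_all add: pairing_commute isotropic_triple_def)
  then have "pairing a1 b2 = 0" "pairing a2 b2 = 1" "pairing a3 b2 = 0" "pairing b1 b2 = 0"
    using a b z by (simp_all add: b2_def pairing_linear)
  then show ?thesis using extend_b3 [OF a b] by blast
qed

lemma extend_b1_b2_b3:
  assumes a: "isotropic_triple a1 a2 a3"
  shows "\<exists>b1 b2 b3. symplectic_basis a1 b1 a2 b2 a3 b3"
proof -
  obtain b1 where "pairing a1 b1 = 1" "pairing a2 b1 = 0" "pairing a3 b1 = 0"
    using isotropic_triple_dual a by metis
  then show ?thesis using extend_b2_b3 [OF a] by blast
qed

lemma extend_a2:
  assumes "pairing a1 b1 = 1"
  shows "\<exists>a2. a2 \<noteq> 0 \<and> a2 \<noteq> a1 \<and> pairing a1 a2 = 0 \<and> pairing b1 a2 = 0"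
proof -
  have ne: "a1 \<noteq> 0" "b1 \<noteq> 0" "a1 \<noteq> b1" using assms by auto
  have "card (perp (span2 a1 b1)) = 16"
    using card_perp [OF subspace_span2, of a1 b1] card_span2 [OF ne] by simp
  moreover have "card {0} = 1" by simp
  ultimately obtain a2 where "a2 \<in> perp (span2 a1 b1)" "a2 \<noteq> 0"
    by (metis card_mono finite_e3 numeral_le_one_iff semiring_norm(69) singleton_iff subsetI)
  then show ?thesis using assms by (intro exI [of _ a2]) (auto simp: perp_span2 pairing_commute)
qed

lemma extend_a3:
  assumes a: "a1 \<noteq> 0" "a2 \<noteq> 0" "a1 \<noteq> a2" "pairing a1 a2 = 0"
  shows "\<exists>a3. isotropic_triple a1 a2 a3"
proof -
  have "card (perp (span2 a1 a2)) = 16"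
    using card_perp [OF subspace_span2, of a1 a2] card_span2 [OF a(1,2,3)] by simp
  then have "\<not> perp (span2 a1 a2) \<subseteq> span2 a1 a2"
    using card_span2 [OF a(1,2,3)] card_mono [OF finite_e3, of "perp (span2 a1 a2)" "span2 a1 a2"]
    by auto
  then obtain a3 where "a3 \<in> perp (span2 a1 a2)" "a3 \<notin> span2 a1 a2" by blast
  then show ?thesis using a unfolding perp_span2
    by (intro exI [of _ a3]) (auto simp: isotropic_triple_def span2_def)
qed

text \<open>The correction terms that make \<open>a\<^sub>3\<close> orthogonal to \<open>b\<^sub>1\<close> and \<open>b\<^sub>2\<close> lie in the span of
  \<open>a\<^sub>1\<close> and \<open>a\<^sub>2\<close>, so \<open>a\<^sub>3\<close> stays outside that span.\<close>

lemma extend_a3_orthogonal: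
  assumes p: "pairing a1 b1 = 1" "pairing a2 b2 = 1"
    "pairing a1 a2 = 0" "pairing a1 b2 = 0" "pairing b1 a2 = 0" "pairing b1 b2 = 0"
  shows "\<exists>a3. a3 \<noteq> 0 \<and> pairing a1 a3 = 0 \<and> pairing b1 a3 = 0 \<and> pairing a2 a3 = 0 \<and> pairing b2 a3 = 0"
proof -
  have ne: "a1 \<noteq> 0" "a2 \<noteq> 0" "a1 \<noteq> a2" using p by auto
  obtain z where z: "isotropic_triple a1 a2 z" using extend_a3 [OF ne p(3)] by blast
  define a3 where "a3 = z + scale_e3 (pairing b1 z) a1 + scale_e3 (pairing b2 z) a2"
  have "pairing b1 a1 = 1" "pairing b2 a2 = 1" "pairing a2 a1 = 0" "pairing b2 a1 = 0"
    using p by (simp_all add: pairing_commute)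
  moreover have "a3 \<noteq> 0"
    using z unfolding a3_def scale_e3_def isotropic_triple_def by (auto simp: e3_simps e3_add_eq_iff)
  ultimately show ?thesis
    using p z by (intro exI [of _ a3]) (simp add: a3_def pairing_linear isotropic_triple_def)
qed

lemma orthogonal_pairs_isotropic_triple:
  assumes p: "pairing a1 b1 = 1" "pairing a2 b2 = 1"
    "pairing a1 a2 = 0" "pairing a1 b2 = 0" "pairing b1 a2 = 0" "pairing b1 b2 = 0"
    and a3: "a3 \<noteq> 0" "pairing a1 a3 = 0" "pairing b1 a3 = 0" "pairing a2 a3 = 0" "pairing b2 a3 = 0"
  shows "isotropic_triple a1 a2 a3"
proof -
  have "a1 + a2 \<noteq> a3"
    using p a3 by (auto simp: pairing_add_right pairing_commute)
  moreover have "a1 \<noteq> a3" "a2 \<noteq> a3" "a1 \<noteq> a2"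
    using p a3 by (auto simp: pairing_commute)
  ultimately show ?thesis using p a3 by (auto simp: isotropic_triple_def)
qed

lemma exists_symplectic_basis: "\<exists>a1 b1 a2 b2 a3 b3. symplectic_basis a1 b1 a2 b2 a3 b3"
proof -
  have "card (UNIV :: e3 set) \<noteq> card {0 :: e3}" by (simp add: card_UNIV_e3)
  then obtain a1 :: e3 where a1: "a1 \<noteq> 0" by (metis UNIV_eq_I singletonI)
  obtain b1 where "pairing a1 b1 = 1" using a1 by (rule pairing_nondegenerate)
  then obtain a2 where "a2 \<noteq> 0" "a2 \<noteq> a1" "pairing a1 a2 = 0" using extend_a2 by blast
  then show ?thesis using extend_a3 [of a1 a2] a1 extend_b1_b2_b3 by blast
qed

lemma symplectic_basis_perp:
  assumes "symplectic_basis a1 b1 a2 b2 a3 b3"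
    and w: "pairing a1 w = 0" "pairing b1 w = 0" "pairing a2 w = 0" "pairing b2 w = 0"
      "pairing a3 w = 0" "pairing b3 w = 0"
  shows "w = 0"
proof -
  have "w \<in> span3 a1 a2 a3"
    using isotropic_triple_maximal symplectic_basis_isotropic_triple assms by blast
  moreover have "pairing b1 a1 = 1" "pairing b2 a2 = 1" "pairing b3 a3 = 1" "pairing b2 a1 = 0"
    "pairing b3 a1 = 0" "pairing b3 a2 = 0"
    using assms(1) by (simp_all add: pairing_commute symplectic_basis_def)
  ultimately show ?thesis
    using assms unfolding span3_eq symplectic_basis_def
    by (auto simp: pairing_add_right)
qed

lemma symplectic_basis_expansion:
  assumes "symplectic_basis a1 b1 a2 b2 a3 b3"
  shows "w = scale_e3 (pairing w b1) a1 + scale_e3 (pairing w a1) b1 +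
             scale_e3 (pairing w b2) a2 + scale_e3 (pairing w a2) b2 +
             scale_e3 (pairing w b3) a3 + scale_e3 (pairing w a3) b3" (is "w = ?w")
proof -
  have comm: "pairing b1 a1 = 1" "pairing b2 a2 = 1" "pairing b3 a3 = 1"
    "pairing a2 a1 = 0" "pairing b2 a1 = 0" "pairing a3 a1 = 0" "pairing b3 a1 = 0"
    "pairing a2 b1 = 0" "pairing b2 b1 = 0" "pairing a3 b1 = 0" "pairing b3 b1 = 0"
    "pairing a3 a2 = 0" "pairing b3 a2 = 0" "pairing a3 b2 = 0" "pairing b3 b2 = 0"
    using assms by (simp_all add: pairing_commute symplectic_basis_def)
  have "w + ?w = 0"
    by (rule symplectic_basis_perp [OF assms])
      (use assms comm in \<open>simp_all add: symplectic_basis_def pairing_linear pairing_commute [of _ w]\<close>)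
  then show ?thesis by (simp only: add_eq_0_iff e3_uminus)
qed

text \<open>The linear map that matches two symplectic bases is read off from the expansion in a
  symplectic basis, where the coordinates are pairings with the dual vectors.\<close>

lemma Sp62_transitive:
  assumes s: "symplectic_basis a1 b1 a2 b2 a3 b3" and s': "symplectic_basis a1' b1' a2' b2' a3' b3'"
  obtains f where "f \<in> carrier Sp62" "f a1 = a1'" "f b1 = b1'" "f a2 = a2'" "f b2 = b2'"
    "f a3 = a3'" "f b3 = b3'"
proof -
  define f where "f w = scale_e3 (pairing w b1) a1' + scale_e3 (pairing w a1) b1' +
             scale_e3 (pairing w b2) a2' + scale_e3 (pairing w a2) b2' +
             scale_e3 (pairing w b3) a3' + scale_e3 (pairing w a3) b3'" for w
  have comm: "pairing b1 a1 = 1" "pairing b2 a2 = 1" "pairing b3 a3 = 1"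
    "pairing a2 a1 = 0" "pairing b2 a1 = 0" "pairing a3 a1 = 0" "pairing b3 a1 = 0"
    "pairing a2 b1 = 0" "pairing b2 b1 = 0" "pairing a3 b1 = 0" "pairing b3 b1 = 0"
    "pairing a3 a2 = 0" "pairing b3 a2 = 0" "pairing a3 b2 = 0" "pairing b3 b2 = 0"
    using s by (simp_all add: pairing_commute symplectic_basis_def)
  have comm': "pairing b1' a1' = 1" "pairing b2' a2' = 1" "pairing b3' a3' = 1"
    "pairing a2' a1' = 0" "pairing b2' a1' = 0" "pairing a3' a1' = 0" "pairing b3' a1' = 0"
    "pairing a2' b1' = 0" "pairing b2' b1' = 0" "pairing a3' b1' = 0" "pairing b3' b1' = 0"
    "pairing a3' a2' = 0" "pairing b3' a2' = 0" "pairing a3' b2' = 0" "pairing b3' b2' = 0"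
    using s' by (simp_all add: pairing_commute symplectic_basis_def)
  have add: "f (x + y) = f x + f y" for x y
    unfolding f_def pairing_add_left e3.scale_left_distrib by (simp only: add_ac)
  have pairing_f: "pairing (f x) (f y) = pairing x y" for x y
  proof -
    have "pairing (f x) (f y) =
      pairing x b1 * pairing y a1 + pairing x a1 * pairing y b1 +
      pairing x b2 * pairing y a2 + pairing x a2 * pairing y b2 +
      pairing x b3 * pairing y a3 + pairing x a3 * pairing y b3"
      by (simp only: f_def pairing_linear comm' s' [unfolded symplectic_basis_def] pairing_self
          mult_zero_right mult_1_right add_0_left add_0_right distrib_left distrib_right) (simp only: mult.commute add_ac)
    also have "\<dots> = pairing (scale_e3 (pairing x b1) a1 + scale_e3 (pairing x a1) b1 +
             scale_e3 (pairing x b2) a2 + scale_e3 (pairing x a2) b2 +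
             scale_e3 (pairing x b3) a3 + scale_e3 (pairing x a3) b3) y"
      by (simp only: pairing_linear pairing_commute [of _ y])
    also have "\<dots> = pairing x y"
      by (simp flip: symplectic_basis_expansion [OF s, of x])
    finally show ?thesis .
  qed
  have "inj f"
  proof (rule injI)
    fix x y assume "f x = f y"
    then have "pairing (x + y) z = 0" for z
      by (metis pairing_f add e3_add_self pairing_0(1))
    then show "x = y"
      by (metis pairing_nondegenerate add_eq_0_iff e3_uminus zero_neq_one)
  qed
  then have "bij f" by (simp add: bij_def finite_UNIV_inj_surj)
  then have "f \<in> carrier Sp62" using add pairing_f by (simp add: Sp62_def e3_linear_iff)
  then show ?thesis
    using that s comm by (simp add: f_def symplectic_basis_def scale_e3_def)
qed

section \<open>Compatible collections as configurations\<close>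

definition hyperbolic_plane :: "e3 set \<Rightarrow> bool" where
  "hyperbolic_plane P \<longleftrightarrow> (\<exists>x y. pairing x y = 1 \<and> P = span2 x y)"

text \<open>A subspace of dimension \<open>3\<close> on which the pairing has rank \<open>2\<close>; projectively, it is the cone with
  vertex \<open>v\<close> over a hyperbolic line.\<close>

definition cone :: "e3 \<Rightarrow> e3 set \<Rightarrow> bool" where
  "cone v T \<longleftrightarrow> (\<exists>x y. pairing x y = 1 \<and> v \<noteq> 0 \<and> pairing x v = 0 \<and> pairing y v = 0 \<and> T = span3 x y v)"

lemma pairing_1D:
  assumes "pairing x y = 1"
  shows "x \<noteq> 0" "y \<noteq> 0" "x \<noteq> y"
  using assms by auto

lemma hyperbolic_plane_subspace: "hyperbolic_plane P \<Longrightarrow> e3.subspace P"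
  by (auto simp: hyperbolic_plane_def)

lemma hyperbolic_plane_card: "hyperbolic_plane P \<Longrightarrow> card P = 4"
  unfolding hyperbolic_plane_def by (metis card_span2 pairing_1D)

lemma hyperbolic_plane_not_isotropic: "hyperbolic_plane P \<Longrightarrow> \<not> isotropic P"
  by (auto simp: hyperbolic_plane_def isotropic_def span2_def)

lemma hyperbolic_plane_Int_perp:
  assumes "hyperbolic_plane P" "w \<in> P" "w \<in> perp P"
  shows "w = 0"
  using assms unfolding hyperbolic_plane_def
  by (auto simp: perp_span2) (auto simp: span2_def pairing_add_right pairing_commute)

lemma cone_subspace: "cone v T \<Longrightarrow> e3.subspace T"
  by (auto simp: cone_def)

lemma cone_card:
  assumes "cone v T"
  shows "card T = 8"
proof -
  obtain x y where T: "T = span3 x y v" and xy: "pairing x y = 1" "v \<noteq> 0" "pairing x v = 0" "pairing y v = 0"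
    using assms by (auto simp: cone_def)
  have "x + y \<noteq> v" "x \<noteq> v" "y \<noteq> v"
    using xy by (auto simp: pairing_add_right pairing_commute)
  then show ?thesis
    unfolding T using xy pairing_1D [OF xy(1)] by (intro card_span3) auto
qed

lemma cone_not_isotropic: "cone v T \<Longrightarrow> \<not> isotropic T"
  by (auto simp: cone_def isotropic_def span3_eq)

lemma cone_Int_perp:
  assumes "cone v T"
  shows "T \<inter> perp T = {0, v}"
proof -
  obtain x y where T: "T = span3 x y v" and xy: "pairing x y = 1" "v \<noteq> 0" "pairing x v = 0" "pairing y v = 0"
    using assms by (auto simp: cone_def)
  have "w \<in> {0, v}" if "w \<in> T" "w \<in> perp T" for w
  proof -
    have "pairing y x = 1" using xy by (simp add: pairing_commute)
    moreover have "pairing x w = 0" "pairing y w = 0" using that by (auto simp: T perp_span3)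
    ultimately show ?thesis using that(1) xy unfolding T span3_eq by (auto simp: pairing_add_right)
  qed
  moreover have "0 \<in> T" "0 \<in> perp T" "v \<in> T" "v \<in> perp T"
    using xy by (auto simp: T perp_span3) (auto simp: span3_eq)
  ultimately show ?thesis by blast
qed

text \<open>Any hyperbolic pair inside a cone can serve as its base. This freedom is used to adapt the base
  to the points and planes of a configuration.\<close>

lemma cone_span3:
  assumes T: "cone v T" and xy: "x \<in> T" "y \<in> T" "pairing x y = 1"
  shows "T = span3 x y v"
proof -
  have v: "v \<in> T" "v \<in> perp T" using cone_Int_perp [OF T] by auto
  then have vxy: "pairing x v = 0" "pairing y v = 0" "v \<noteq> 0"
    using xy T by (auto simp: perp_def cone_def)
  then have "cone v (span3 x y v)" using xy by (auto simp: cone_def)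
  then have "card (span3 x y v) = 8" by (rule cone_card)
  moreover have "span3 x y v \<subseteq> T"
    using T xy v by (intro span3_subset cone_subspace)
  ultimately show ?thesis using cone_card [OF T] by (metis card_subset_eq finite_e3)
qed

lemma hyperbolic_plane_span2:
  assumes P: "hyperbolic_plane P" and xy: "x \<in> P" "y \<in> P" "pairing x y = 1"
  shows "P = span2 x y"
proof -
  have "card (span2 x y) = 4" using pairing_1D [OF xy(3)] by (intro card_span2) auto
  moreover have "span2 x y \<subseteq> P"
    using P xy by (intro span2_subset hyperbolic_plane_subspace)
  ultimately show ?thesis using hyperbolic_plane_card [OF P] by (metis card_subset_eq finite_e3)
qed

lemma not_isotropic_card_4:
  assumes X: "e3.subspace X" "card X = 4" "\<not> isotropic X"
  shows "hyperbolic_plane X"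
proof -
  obtain x y where xy: "x \<in> X" "y \<in> X" "pairing x y = 1"
    using X(3) by (auto simp: isotropic_def)
  have "card (span2 x y) = 4" using pairing_1D [OF xy(3)] by (intro card_span2) auto
  moreover have "span2 x y \<subseteq> X" using X xy by (intro span2_subset)
  ultimately have "span2 x y = X" using X(2) by (metis card_subset_eq finite_e3)
  then show ?thesis using xy by (auto simp: hyperbolic_plane_def)
qed

text \<open>The vertex is the component, orthogonal to a hyperbolic pair \<open>x, y\<close>, of any vector outside
  the span of \<open>x\<close> and \<open>y\<close>.\<close>

lemma not_isotropic_card_8:
  assumes X: "e3.subspace X" "card X = 8" "\<not> isotropic X"
  shows "\<exists>v. cone v X"
proof -
  obtain x y where xy: "x \<in> X" "y \<in> X" "pairing x y = 1"
    using X(3) by (auto simp: isotropic_def)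
  have "card (span2 x y) = 4" using pairing_1D [OF xy(3)] by (intro card_span2) auto
  then have "span2 x y \<noteq> X" using X(2) by auto
  moreover have "span2 x y \<subseteq> X" using X xy by (intro span2_subset)
  ultimately obtain z where z: "z \<in> X" "z \<notin> span2 x y" by blast
  define v where "v = z + scale_e3 (pairing y z) x + scale_e3 (pairing x z) y"
  have "v \<in> X" using X(1) xy z by (auto simp: v_def e3_subspace_iff scale_e3_def)
  moreover have "v \<noteq> 0"
    using z(2) by (auto simp: v_def scale_e3_def span2_def e3_simps e3_add_eq_iff split: if_splits)
  moreover have "pairing y x = 1" using xy by (simp add: pairing_commute)
  then have "pairing x v = 0" "pairing y v = 0"
    using xy by (simp_all add: v_def pairing_linear)
  ultimately have "cone v (span3 x y v)" "span3 x y v \<subseteq> X"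
    using xy span3_subset [OF X(1)] by (auto simp: cone_def)
  then show ?thesis using X(2) cone_card by (metis card_subset_eq finite_e3)
qed

lemma subspace_card_le_8:
  assumes X: "e3.subspace X" "card X \<le> 8"
  shows "card X \<in> {1, 2, 4, 8}"
proof -
  have "(2 :: nat) ^ e3.dim X \<le> 2 ^ 3" using X e3_card_dim [OF X(1)] by simp
  then have "e3.dim X \<le> 3" by (subst (asm) power_increasing_iff) simp_all
  then have "e3.dim X \<in> {0, 1, 2, 3}" by auto
  then show ?thesis using e3_card_dim [OF X(1)] by auto
qed

lemma subspace_card_1: "e3.subspace X \<Longrightarrow> card X = 1 \<Longrightarrow> X = {0}"
  by (auto simp: e3_subspace_iff card_1_singleton_iff)

lemma subspace_card_2: "e3.subspace X \<Longrightarrow> card X = 2 \<Longrightarrow> \<exists>v. v \<noteq> 0 \<and> X = {0, v}"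
  by (auto simp: e3_subspace_iff card_2_iff)

lemma subspace_point [simp]: "e3.subspace {0, v}"
  by (auto simp: e3_subspace_iff e3_simps)

lemma subspace_0_set [simp]: "e3.subspace {0}"
  by (auto simp: e3_subspace_iff)

lemma perp_0_set: "perp {0} = UNIV"
  by (simp add: perp_def)

text \<open>The members of the pairs that may stand in the first place. A pair of cones contributes both
  of its members, so that conditions on ordered pairs become conditions on single
  subspaces.\<close>

definition small_members :: "e3 set set set \<Rightarrow> e3 set set" where
  "small_members L = {X. e3.subspace X \<and> card X \<le> 8 \<and> {X, perp X} \<in> L}"

lemma ordered_pairs_eq: "ordered_pairs L = (\<lambda>X. (X, perp X)) ` small_members L"
  unfolding ordered_pairs_def small_members_def using dim_le_dim_perp_iff by blast

lemma pair_eq_iff: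
  assumes "e3.subspace X" "e3.subspace Y"
  shows "{X, perp X} = {Y, perp Y} \<longleftrightarrow> Y = X \<or> Y = perp X"
  using perp_perp [OF assms(1)] perp_perp [OF assms(2)] by (metis doubleton_eq_iff)

lemma compatible_iff:
  "compatible L \<longleftrightarrow>
     (\<forall>p\<in>L. \<exists>X. e3.subspace X \<and> p = {X, perp X}) \<and>
     {0} \<in> small_members L \<and>
     (\<forall>X\<in>small_members L. card X \<le> 2 \<or> \<not> isotropic X) \<and>
     (\<forall>X\<in>small_members L. \<forall>Y\<in>small_members L.
        Y \<noteq> X \<and> Y \<noteq> perp X \<longrightarrow> X \<subseteq> Y \<or> Y \<subseteq> X \<or> X \<subseteq> perp Y) \<and>
     (\<forall>X\<in>small_members L - {{0}}. \<forall>Y\<in>small_members L - {{0}}.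
        Y \<noteq> X \<and> Y \<noteq> perp X \<longrightarrow> \<not> X \<subseteq> Y \<inter> perp Y \<and> \<not> Y \<subseteq> X \<inter> perp X)"
proof -
  have sub: "e3.subspace X" if "X \<in> small_members L" for X
    using that by (simp add: small_members_def)
  have zero: "({0}, UNIV) \<in> ordered_pairs L \<longleftrightarrow> {0} \<in> small_members L"
    by (auto simp: ordered_pairs_eq perp_0_set image_iff)
  have diff: "ordered_pairs L - {({0}, UNIV)} = (\<lambda>X. (X, perp X)) ` (small_members L - {{0}})"
    unfolding ordered_pairs_eq perp_0_set [symmetric] by blast
  show ?thesis
    unfolding compatible_def zero diff unfolding ordered_pairs_eq
    by (simp add: sub DiffD1 [THEN sub] dim_le_1_iff pair_eq_iff del: One_nat_def Diff_iff cong: ball_cong)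
qed

definition members :: "e3 set \<Rightarrow> e3 set set \<Rightarrow> e3 set set \<Rightarrow> e3 set set" where
  "members S \<P> \<T> = insert {0} ((\<lambda>v. {0, v}) ` S \<union> \<P> \<union> \<T>)"

definition collection :: "e3 set \<Rightarrow> e3 set set \<Rightarrow> e3 set set \<Rightarrow> e3 set set set" where
  "collection S \<P> \<T> = (\<lambda>X. {X, perp X}) ` members S \<P> \<T>"

text \<open>Excluding the vertex \<open>v\<close> from the points is the only instance of the last compatibility
  condition that is not automatic: \<open>{0, v} = T \<inter> T\<^sup>\<bottom>\<close>.\<close>

definition cone_condition :: "e3 set \<Rightarrow> e3 set set \<Rightarrow> e3 \<Rightarrow> e3 set \<Rightarrow> bool" where
  "cone_condition S \<P> v T \<longleftrightarrow> cone v T \<and> cone v (perp T) \<and> v \<notin> S \<and> S \<subseteq> T \<union> perp T \<and>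
     (\<forall>P\<in>\<P>. P \<subseteq> T \<or> P \<subseteq> perp T)"

lemma cone_condition_perp:
  assumes "cone_condition S \<P> v T"
  shows "cone_condition S \<P> v (perp T)"
  using assms perp_perp [OF cone_subspace, of v T] unfolding cone_condition_def by (metis Un_commute)

definition configuration :: "e3 set \<Rightarrow> e3 set set \<Rightarrow> e3 set set \<Rightarrow> bool" where
  "configuration S \<P> \<T> \<longleftrightarrow>
     0 \<notin> S \<and> isotropic S \<and>
     (\<forall>P\<in>\<P>. hyperbolic_plane P \<and> S \<subseteq> P \<union> perp P) \<and>
     (\<forall>P\<in>\<P>. \<forall>Q\<in>\<P>. P \<noteq> Q \<longrightarrow> P \<subseteq> perp Q) \<and>
     (\<T> = {} \<or> (\<exists>v T. \<T> = {T, perp T} \<and> cone_condition S \<P> v T))"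

definition points :: "e3 set set set \<Rightarrow> e3 set" where
  "points L = {v. v \<noteq> 0 \<and> {0, v} \<in> small_members L}"

definition planes :: "e3 set set set \<Rightarrow> e3 set set" where
  "planes L = {X \<in> small_members L. card X = 4}"

definition cones :: "e3 set set set \<Rightarrow> e3 set set" where
  "cones L = {X \<in> small_members L. card X = 8}"

lemma configuration_cone_condition:
  assumes c: "configuration S \<P> \<T>" and T: "T \<in> \<T>"
  obtains v where "cone_condition S \<P> v T" "\<T> = {T, perp T}"
proof -
  obtain v T0 where T0: "\<T> = {T0, perp T0}" "cone_condition S \<P> v T0"
    using c T unfolding configuration_def by blast
  then have pp: "perp (perp T0) = T0"
    using perp_perp cone_subspace unfolding cone_condition_def by blast
  have "T = T0 \<or> T = perp T0" using T T0(1) by blast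
  then show ?thesis
  proof
    assume "T = perp T0"
    then have "cone_condition S \<P> v T" "\<T> = {T, perp T}"
      using cone_condition_perp [OF T0(2)] T0(1) pp by (simp_all add: insert_commute)
    then show ?thesis by (rule that)
  qed (use T0 that in blast)
qed

lemma configuration_hyperbolic_plane:
  "configuration S \<P> \<T> \<Longrightarrow> P \<in> \<P> \<Longrightarrow> hyperbolic_plane P"
  by (simp add: configuration_def)

lemma configuration_cone:
  assumes "configuration S \<P> \<T>" "T \<in> \<T>"
  shows "\<exists>v. cone v T"
  by (rule configuration_cone_condition [OF assms]) (auto simp: cone_condition_def)

lemma members_cases:
  assumes "X \<in> members S \<P> \<T>"
  obtains "X = {0}" | u where "u \<in> S" "X = {0, u}" | "X \<in> \<P>" | "X \<in> \<T>"
  using assms unfolding members_def by blast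

lemma card_point_le: "card {0, v} \<le> 2"
  by (simp add: card_insert_if)

text \<open>The complement of a point or a plane has more than \<open>8\<close> elements, and the set of cones is
  closed under complements, so no new small member arises.\<close>

lemma small_members_collection:
  assumes "configuration S \<P> \<T>"
  shows "small_members (collection S \<P> \<T>) = members S \<P> \<T>"
proof
  have sub: "e3.subspace X \<and> (X \<in> \<T> \<or> card X < 8) \<and> card X \<le> 8" if "X \<in> members S \<P> \<T>" for X
    using that
  proof (cases rule: members_cases)
    case (2 u)
    then show ?thesis using card_point_le [of u] by simp
  next
    case 3
    then show ?thesis
      using configuration_hyperbolic_plane [OF assms] hyperbolic_plane_subspace hyperbolic_plane_card by simp
  next
    case 4
    then show ?thesis
      using configuration_cone [OF assms] cone_subspace cone_card by fastforce
  qed simp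
  then show "members S \<P> \<T> \<subseteq> small_members (collection S \<P> \<T>)"
    by (auto simp: small_members_def collection_def)
  have T: "perp Y \<in> \<T>" if "Y \<in> \<T>" for Y
    by (rule configuration_cone_condition [OF assms that]) simp
  show "small_members (collection S \<P> \<T>) \<subseteq> members S \<P> \<T>"
  proof
    fix X assume "X \<in> small_members (collection S \<P> \<T>)"
    then obtain Y where X: "e3.subspace X" "card X \<le> 8" and Y: "Y \<in> members S \<P> \<T>"
      "{X, perp X} = {Y, perp Y}"
      by (auto simp: small_members_def collection_def)
    then have "Y = X \<or> X = perp Y"
      using pair_eq_iff sub by metis
    then show "X \<in> members S \<P> \<T>"
    proof
      assume XY: "X = perp Y"
      have "card Y * card X = 64" using card_perp sub Y(1) XY by blast
      then have "\<not> card Y < 8"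
        using X(2) mult_le_mono [of "card Y" 7 "card X" 8] by linarith
      then show ?thesis using sub [OF Y(1)] T XY by (auto simp: members_def)
    qed (use Y in simp)
  qed
qed

text \<open>The cardinality of a small member tells its kind, so the collection determines the triple.\<close>

lemma
  assumes "configuration S \<P> \<T>"
  shows points_collection: "points (collection S \<P> \<T>) = S"
    and planes_collection: "planes (collection S \<P> \<T>) = \<P>"
    and cones_collection: "cones (collection S \<P> \<T>) = \<T>"
proof -
  have P: "card P = 4" if "P \<in> \<P>" for P
    using assms that by (auto simp: configuration_def hyperbolic_plane_card)
  have T: "card T = 8" if "T \<in> \<T>" for T
    using configuration_cone [OF assms that] cone_card by metis
  have S: "v \<noteq> 0" "card {0, v} = 2" if "v \<in> S" for v
    using assms that by (auto simp: configuration_def card_insert_if)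
  note m = small_members_collection [OF assms]
  have mem: "X \<in> members S \<P> \<T> \<longleftrightarrow> X = {0} \<or> (\<exists>u\<in>S. X = {0, u}) \<or> X \<in> \<P> \<or> X \<in> \<T>" for X
    by (auto simp: members_def)
  have "v \<noteq> 0 \<and> {0, v} \<in> members S \<P> \<T> \<longleftrightarrow> v \<in> S" for v
  proof
    assume v: "v \<noteq> 0 \<and> {0, v} \<in> members S \<P> \<T>"
    then have "card {0, v} = 2" by simp
    then have "\<exists>u\<in>S. {0, v} = {0, u}" using v P [of "{0, v}"] T [of "{0, v}"] unfolding mem by auto
    then show "v \<in> S" using v by (auto simp: doubleton_eq_iff)
  qed (use S mem in auto)
  then show "points (collection S \<P> \<T>) = S"
    unfolding points_def m by blast
  have "X \<in> members S \<P> \<T> \<and> card X = 4 \<longleftrightarrow> X \<in> \<P>" for X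
    unfolding mem using S P [of X] T [of X] by auto
  then show "planes (collection S \<P> \<T>) = \<P>"
    unfolding planes_def m by blast
  have "X \<in> members S \<P> \<T> \<and> card X = 8 \<longleftrightarrow> X \<in> \<T>" for X
    unfolding mem using S P [of X] T [of X] by auto
  then show "cones (collection S \<P> \<T>) = \<T>"
    unfolding cones_def m by blast
qed

lemma point_subset: "e3.subspace X \<Longrightarrow> v \<in> X \<Longrightarrow> {0, v} \<subseteq> X"
  by (simp add: e3_subspace_iff)

lemma configuration_compatible:
  assumes "configuration S \<P> \<T>"
  shows "compatible (collection S \<P> \<T>)"
proof -
  have nz: "0 \<notin> S" and iso: "isotropic S"
    and S_P: "\<And>P. P \<in> \<P> \<Longrightarrow> S \<subseteq> P \<union> perp P"
    and PP: "\<And>P Q. P \<in> \<P> \<Longrightarrow> Q \<in> \<P> \<Longrightarrow> P \<noteq> Q \<Longrightarrow> P \<subseteq> perp Q"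
    using assms unfolding configuration_def by simp_all
  have sub: "e3.subspace X" if "X \<in> members S \<P> \<T>" for X
    using that small_members_collection [OF assms] by (auto simp: small_members_def)
  have SS: "{0, u} \<subseteq> perp {0, w}" if "u \<in> S" "w \<in> S" for u w
  proof -
    have "pairing u w = 0" using iso that by (simp add: isotropic_def)
    then show ?thesis by (simp add: perp_iff_pairing)
  qed
  have SP: "{0, u} \<subseteq> P \<or> {0, u} \<subseteq> perp P" if "u \<in> S" "P \<in> \<P>" for u P
  proof -
    have "u \<in> P \<or> u \<in> perp P" using S_P that by blast
    moreover have "e3.subspace P"
      using that configuration_hyperbolic_plane [OF assms] hyperbolic_plane_subspace by blast
    ultimately show ?thesis using point_subset subspace_perp by metis
  qed
  have T: "\<exists>v. cone_condition S \<P> v T \<and> \<T> = {T, perp T}" if "T \<in> \<T>" for T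
    by (rule configuration_cone_condition [OF assms that]) blast
  have ST: "{0, u} \<subseteq> T \<or> {0, u} \<subseteq> perp T" if u: "u \<in> S" and mem: "T \<in> \<T>" for u T
  proof -
    obtain v where v: "cone_condition S \<P> v T" using T [OF mem] by blast
    then have "S \<subseteq> T \<union> perp T" "e3.subspace T"
      using cone_subspace unfolding cone_condition_def by blast+
    then show ?thesis using point_subset [of T] point_subset [of "perp T"] u by auto
  qed
  have PT: "P \<subseteq> T \<or> P \<subseteq> perp T" if "P \<in> \<P>" "T \<in> \<T>" for P T
    using T [OF that(2)] that(1) unfolding cone_condition_def by blast
  have TT: "T' = T \<or> T' = perp T" if "T \<in> \<T>" "T' \<in> \<T>" for T T'
    using T [OF that(1)] that(2) by blast
  have 0: "{0} \<subseteq> X" if "X \<in> members S \<P> \<T>" for X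
    using sub [OF that] by (simp add: e3_subspace_iff)
  have laminar: "X \<subseteq> Y \<or> Y \<subseteq> X \<or> X \<subseteq> perp Y"
    if X: "X \<in> members S \<P> \<T>" and Y: "Y \<in> members S \<P> \<T>" and ne: "Y \<noteq> X" "Y \<noteq> perp X" for X Y
    using X
  proof (cases rule: members_cases)
    case 1
    then show ?thesis using 0 [OF Y] by blast
  next
    case (2 u)
    show ?thesis
      using Y
    proof (cases rule: members_cases)
      case 1
      then show ?thesis using 0 [OF X] by blast
    next
      case w: (2 w)
      show ?thesis unfolding 2(2) w(2) using SS [OF 2(1) w(1)] by blast
    next
      case 3
      show ?thesis unfolding 2(2) using SP [OF 2(1) 3] by blast
    next
      case 4
      show ?thesis unfolding 2(2) using ST [OF 2(1) 4] by blast
    qed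
  next
    case 3
    show ?thesis
      using Y
    proof (cases rule: members_cases)
      case 1
      then show ?thesis using 0 [OF X] by blast
    next
      case w: (2 w)
      show ?thesis using SP [OF w(1) 3] subset_perp_commute unfolding w(2) by blast
    next
      case Q: 3
      show ?thesis using PP [OF 3 Q] ne by blast
    next
      case 4
      show ?thesis using PT [OF 3 4] by blast
    qed
  next
    case 4
    show ?thesis
      using Y
    proof (cases rule: members_cases)
      case 1
      then show ?thesis using 0 [OF X] by blast
    next
      case w: (2 w)
      show ?thesis using ST [OF w(1) 4] subset_perp_commute unfolding w(2) by blast
    next
      case 3
      show ?thesis using PT [OF 3 4] subset_perp_commute by blast
    next
      case T': 4
      show ?thesis using TT [OF 4 T'] ne by blast
    qed
  qed
  have nondeg: "\<not> X \<subseteq> Y \<inter> perp Y"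
    if "X \<in> members S \<P> \<T>" "Y \<in> members S \<P> \<T>" "X \<noteq> {0}" "Y \<noteq> {0}" "Y \<noteq> X" "Y \<noteq> perp X" for X Y
  proof
    assume sub_X: "X \<subseteq> Y \<inter> perp Y"
    have X0: "0 \<in> X" using sub that(1) by (auto simp: e3_subspace_iff)
    show False
      using that(2)
    proof (cases rule: members_cases)
      case 1
      then show ?thesis using that(4) by contradiction
    next
      case (2 w)
      then have "X = {0} \<or> X = {0, w}" using sub_X X0 by blast
      then show ?thesis using that(3,5) 2 by blast
    next
      case 3
      then have "Y \<inter> perp Y \<subseteq> {0}"
        using hyperbolic_plane_Int_perp configuration_hyperbolic_plane [OF assms] by blast
      then show ?thesis using sub_X X0 that(3) by blast
    next
      case 4
      then obtain v where v: "cone v Y" "v \<notin> S"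
        using T [OF 4] unfolding cone_condition_def by blast
      then have "X = {0} \<or> X = {0, v}" using sub_X X0 cone_Int_perp [OF v(1)] by blast
      then have X: "X = {0, v}" using that(3) by blast
      have "\<exists>u\<in>S. X = {0, u}"
        using that(1)
      proof (cases rule: members_cases)
        case 3
        then have "card X = 4"
          using hyperbolic_plane_card configuration_hyperbolic_plane [OF assms] by blast
        then show ?thesis using card_point_le [of v] X by simp
      next
        case 4
        then have "card X = 8"
          using cone_card configuration_cone [OF assms] by blast
        then show ?thesis using card_point_le [of v] X by simp
      qed (use that(3) in blast)+
      then have "v \<in> S" unfolding X using nz by (auto simp: doubleton_eq_iff)
      then show ?thesis using v by blast
    qed
  qed
  have small: "card X \<le> 2 \<or> \<not> isotropic X" if "X \<in> members S \<P> \<T>" for X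
    using that
  proof (cases rule: members_cases)
    case (2 u)
    then show ?thesis using card_point_le [of u] by simp
  next
    case 3
    then show ?thesis
      using hyperbolic_plane_not_isotropic configuration_hyperbolic_plane [OF assms] by blast
  next
    case 4
    then show ?thesis
      using cone_not_isotropic configuration_cone [OF assms] by blast
  qed simp
  have nondeg': "\<not> X \<subseteq> Y \<inter> perp Y \<and> \<not> Y \<subseteq> X \<inter> perp X"
    if "X \<in> members S \<P> \<T> - {{0}}" "Y \<in> members S \<P> \<T> - {{0}}" "Y \<noteq> X \<and> Y \<noteq> perp X" for X Y
  proof -
    have "X \<noteq> perp Y" using that perp_perp [OF sub, of Y] by auto
    then show ?thesis using nondeg [of X Y] nondeg [of Y X] that by auto
  qed
  have pairs: "\<exists>X. e3.subspace X \<and> p = {X, perp X}" if "p \<in> collection S \<P> \<T>" for p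
    using that sub unfolding collection_def by blast
  have zero: "{0} \<in> members S \<P> \<T>" by (simp add: members_def)
  show ?thesis
    unfolding compatible_iff small_members_collection [OF assms]
    by (intro conjI ballI impI; (elim conjE)?)
      (fact pairs zero small laminar nondeg' [THEN conjunct1, OF _ _ conjI]
        nondeg' [THEN conjunct2, OF _ _ conjI])+
qed

text \<open>Inclusion between distinct small members forces different cardinalities, so for each combination
  of kinds laminarity leaves only the orthogonality or containment required of a configuration. For cones that
  are neither equal nor complementary it leaves nothing, which is why there is at most one pair
  of them.\<close>

lemma compatible_configuration:
  assumes "compatible L"
  shows "configuration (points L) (planes L) (cones L)"
    and "L = collection (points L) (planes L) (cones L)"
proof -
  let ?M = "small_members L"
  note c = assms [unfolded compatible_iff]
  have pair: "\<forall>p\<in>L. \<exists>X. e3.subspace X \<and> p = {X, perp X}"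
    and zero: "{0} \<in> ?M"
    and noniso: "\<forall>X\<in>?M. card X \<le> 2 \<or> \<not> isotropic X"
    and laminar': "\<forall>X\<in>?M. \<forall>Y\<in>?M. Y \<noteq> X \<and> Y \<noteq> perp X \<longrightarrow> X \<subseteq> Y \<or> Y \<subseteq> X \<or> X \<subseteq> perp Y"
    and nondeg: "\<forall>X\<in>?M - {{0}}. \<forall>Y\<in>?M - {{0}}.
        Y \<noteq> X \<and> Y \<noteq> perp X \<longrightarrow> \<not> X \<subseteq> Y \<inter> perp Y \<and> \<not> Y \<subseteq> X \<inter> perp X"
    by (fact c [THEN conjunct1] c [THEN conjunct2, THEN conjunct1]
      c [THEN conjunct2, THEN conjunct2, THEN conjunct1]
      c [THEN conjunct2, THEN conjunct2, THEN conjunct2, THEN conjunct1]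
      c [THEN conjunct2, THEN conjunct2, THEN conjunct2, THEN conjunct2])+
  have laminar: "X \<subseteq> Y \<or> Y \<subseteq> X \<or> X \<subseteq> perp Y"
    if "X \<in> ?M" "Y \<in> ?M" "Y \<noteq> X" "Y \<noteq> perp X" for X Y
    using laminar' [rule_format, OF that(1,2)] that(3,4) by simp
  have sub: "e3.subspace X" and le_8: "card X \<le> 8" if "X \<in> ?M" for X
    using that by (auto simp: small_members_def)
  have M: "?M = members (points L) (planes L) (cones L)"
  proof
    show "members (points L) (planes L) (cones L) \<subseteq> ?M"
      using zero by (auto simp: members_def points_def planes_def cones_def)
    show "?M \<subseteq> members (points L) (planes L) (cones L)"
    proof
      fix X assume X: "X \<in> ?M"
      have "card X \<in> {1, 2, 4, 8}" using subspace_card_le_8 sub le_8 X by blast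
      then show "X \<in> members (points L) (planes L) (cones L)"
        using X subspace_card_1 [OF sub [OF X]] subspace_card_2 [OF sub [OF X]]
        by (auto simp: members_def points_def planes_def cones_def)
    qed
  qed
  have pl: "hyperbolic_plane P" if "P \<in> planes L" for P
    using that noniso [rule_format, of P] sub by (intro not_isotropic_card_4) (auto simp: planes_def)
  have M_perp: "perp X \<in> ?M" if "X \<in> ?M" "card X = 8" for X
    using that card_perp [of X] perp_perp [of X] by (auto simp: small_members_def insert_commute)
  show "L = collection (points L) (planes L) (cones L)"
  proof
    show "collection (points L) (planes L) (cones L) \<subseteq> L"
      unfolding collection_def M [symmetric] by (auto simp: small_members_def)
    show "L \<subseteq> collection (points L) (planes L) (cones L)"
    proof
      fix p assume p: "p \<in> L"
      then obtain X where X: "e3.subspace X" "p = {X, perp X}" using pair by blast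
      have p': "p = {perp X, perp (perp X)}" using X perp_perp by auto
      have "card X \<le> 8 \<or> card (perp X) \<le> 8"
        using card_perp [OF X(1)] mult_le_mono [of 9 "card X" 9 "card (perp X)"] by linarith
      then have "X \<in> ?M \<or> perp X \<in> ?M"
        using p X(1) by (auto simp: small_members_def simp flip: X(2) p')
      then show "p \<in> collection (points L) (planes L) (cones L)"
        unfolding collection_def M [symmetric] using X(2) p' by blast
    qed
  qed
  have SS: "pairing u w = 0" if "u \<in> points L" "w \<in> points L" for u w
  proof (cases "u = w")
    case False
    have uw: "{0, u} \<in> ?M" "{0, w} \<in> ?M" "u \<noteq> 0" "w \<noteq> 0" using that by (auto simp: points_def)
    show ?thesis
    proof (cases "{0, w} = perp {0, u}")
      case True
      then show ?thesis by (auto simp: perp_def)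
    next
      case ne: False
      have "{0, w} \<noteq> {0, u}" using False by (auto simp: doubleton_eq_iff)
      with laminar [OF uw(1,2)] ne have "{0, u} \<subseteq> perp {0, w}" using uw(3,4) False by auto
      then show ?thesis by (auto simp: perp_iff_pairing)
    qed
  qed simp
  have SX: "u \<in> X \<or> u \<in> perp X" if "u \<in> points L" "X \<in> ?M" "card X \<ge> 4" for u X
  proof -
    have u: "{0, u} \<in> ?M" "u \<noteq> 0" using that by (auto simp: points_def)
    have 2: "card {0, u} = 2" using u by simp
    have "card (perp {0, u}) = 32" using card_perp [OF subspace_point, of u] 2 by simp
    then have "X \<noteq> {0, u}" "X \<noteq> perp {0, u}" "\<not> X \<subseteq> {0, u}"
      using 2 that(3) le_8 [OF that(2)] card_mono [OF finite_e3, of X "{0, u}"] by auto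
    then show ?thesis using laminar [OF u(1) that(2)] by auto
  qed
  have PX: "P \<subseteq> X \<or> P \<subseteq> perp X" if "P \<in> planes L" "X \<in> ?M" "card X \<ge> 4" "P \<noteq> X" for P X
  proof -
    have P: "P \<in> ?M" "card P = 4" using that by (auto simp: planes_def)
    have "card (perp P) = 16" using card_perp [OF sub] P by fastforce
    then have "X \<noteq> perp P" "\<not> X \<subseteq> P"
      using P that(3,4) le_8 [OF that(2)] card_seteq [OF finite_e3, of X P] by auto
    then show ?thesis using laminar [OF P(1) that(2)] that(4) by auto
  qed
  have "cones L = {} \<or> (\<exists>v T. cones L = {T, perp T} \<and> cone_condition (points L) (planes L) v T)"
  proof (cases "cones L = {}")
    case False
    then obtain T where T: "T \<in> cones L" by blast
    then have TM: "T \<in> ?M" "card T = 8" by (auto simp: cones_def)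
    have cone: "\<exists>v. cone v X" if "X \<in> ?M" "card X = 8" for X
      using that noniso [rule_format, of X] sub by (intro not_isotropic_card_8) auto
    have T': "perp T \<in> ?M" "card (perp T) = 8"
      using M_perp TM card_perp [OF sub [OF TM(1)]] by auto
    have pp: "perp (perp T) = T" using perp_perp sub TM by blast
    obtain v v' where v: "cone v T" and v': "cone v' (perp T)"
      using cone TM T' by blast
    have "{0, v} = {0, v'}"
      using cone_Int_perp [OF v] cone_Int_perp [OF v'] pp by (simp add: Int_commute)
    then have "v = v'" using v v' by (auto simp: doubleton_eq_iff cone_def)
    have "X = T \<or> X = perp T" if X: "X \<in> cones L" for X
    proof (rule ccontr)
      assume ne: "\<not> (X = T \<or> X = perp T)"
      moreover have "X \<in> ?M" "card X = 8" using X by (auto simp: cones_def)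
      ultimately have "T \<subseteq> X \<or> X \<subseteq> T \<or> X \<subseteq> perp T"
        using laminar [of X T] TM M_perp pp perp_perp sub by metis
      then show False
        using \<open>card X = 8\<close> TM T' ne by (metis card_subset_eq finite_e3)
    qed
    then have "cones L = {T, perp T}" using T T' by (auto simp: cones_def)
    moreover have "v \<notin> points L"
    proof
      assume "v \<in> points L"
      then have vM: "{0, v} \<in> ?M" and "v \<noteq> 0" by (simp_all add: points_def)
      then have 2: "card {0, v} = 2" by simp
      have "card (perp {0, v}) = 32" using card_perp [OF subspace_point, of v] 2 by simp
      then have ne: "T \<noteq> {0, v}" "T \<noteq> perp {0, v}" "T \<noteq> {0}" "{0, v} \<noteq> {0}"
        using TM(2) 2 \<open>v \<noteq> 0\<close> by auto
      have "{0, v} \<subseteq> T \<inter> perp T" using cone_Int_perp [OF v] by simp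
      then show False
        using nondeg [rule_format, of "{0, v}" T] vM TM(1) ne by blast
    qed
    moreover have "points L \<subseteq> T \<union> perp T" using SX [OF _ TM(1)] TM(2) by auto
    moreover have "P \<subseteq> T \<or> P \<subseteq> perp T" if "P \<in> planes L" for P
      using PX [OF that TM(1)] TM that by (auto simp: planes_def)
    ultimately show ?thesis using v v' \<open>v = v'\<close> unfolding cone_condition_def by blast
  qed simp
  moreover have "0 \<notin> points L" by (simp add: points_def)
  moreover have "isotropic (points L)" using SS by (auto simp: isotropic_def)
  moreover have "points L \<subseteq> P \<union> perp P" if "P \<in> planes L" for P
    using SX [of _ P] that by (auto simp: planes_def)
  moreover have "P \<subseteq> perp Q" if "P \<in> planes L" "Q \<in> planes L" "P \<noteq> Q" for P Q
  proof -
    have PQ: "Q \<in> ?M" "card P = 4" "card Q = 4" using that by (auto simp: planes_def)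
    then have "\<not> P \<subseteq> Q" using that(3) card_subset_eq [OF finite_e3, of P Q] by auto
    then show ?thesis using PX [OF that(1) PQ(1)] PQ(3) that(3) by simp
  qed
  ultimately show "configuration (points L) (planes L) (cones L)"
    using pl unfolding configuration_def by simp
qed

section \<open>Normal forms and their signatures\<close>

type_synonym triple = "e3 set \<times> e3 set set \<times> e3 set set"

text \<open>The orbits of subsets of the Fano plane: sizes \<open>3\<close> and \<open>4\<close> occur twice, according to
  whether the set contains a line.\<close>

definition point_forms :: "e3 \<Rightarrow> e3 \<Rightarrow> e3 \<Rightarrow> e3 set list" where
  "point_forms a1 a2 a3 =
     [{}, {a1}, {a1, a2}, {a1, a2, a1 + a2}, {a1, a2, a3}, {a1, a2, a3, a1 + a2},
      {a1, a2, a3, a1 + (a2 + a3)}, {a1, a2, a3, a1 + a2, a1 + a3},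
      {a1, a2, a3, a1 + a2, a1 + a3, a2 + a3},
      {a1, a2, a3, a1 + a2, a1 + a3, a2 + a3, a1 + (a2 + a3)}]"

text \<open>What a configuration can have inside one of its two cones. Two orthogonal points of a cone are
  congruent modulo the vertex, and two planes in it are never orthogonal.\<close>

definition side_forms :: "e3 \<Rightarrow> e3 \<Rightarrow> e3 \<Rightarrow> (e3 set \<times> e3 set set) list" where
  "side_forms a b v =
     [({}, {}), ({a}, {}), ({a, a + v}, {}), ({}, {span2 a b}), ({a}, {span2 a b})]"

definition cone_form :: "e3 \<Rightarrow> e3 \<Rightarrow> e3 \<Rightarrow> e3 \<Rightarrow> e3 \<Rightarrow> nat \<Rightarrow> nat \<Rightarrow> triple" where
  "cone_form a1 b1 a2 b2 v i j =
     (fst (side_forms a1 b1 v ! i) \<union> fst (side_forms a2 b2 v ! j),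
      snd (side_forms a1 b1 v ! i) \<union> snd (side_forms a2 b2 v ! j),
      {span3 a1 b1 v, span3 a2 b2 v})"

definition normal_forms :: "e3 \<Rightarrow> e3 \<Rightarrow> e3 \<Rightarrow> e3 \<Rightarrow> e3 \<Rightarrow> e3 \<Rightarrow> triple list" where
  "normal_forms a1 b1 a2 b2 a3 b3 =
     [(S, {}, {}). S \<leftarrow> point_forms a1 a2 a3] @
     [(S \<union> S', {span2 a1 b1}, {}). S \<leftarrow> [{}, {a1}], S' \<leftarrow> [{}, {a2}, {a2, a3}, {a2, a3, a2 + a3}]] @
     [(S, {span2 a1 b1, span2 a2 b2}, {}). S \<leftarrow> [{}, {a1}, {a1, a2}, {a3}, {a1, a3}, {a1, a2, a3}]] @
     [(S, {span2 a1 b1, span2 a2 b2, span2 a3 b3}, {}). S \<leftarrow> [{}, {a1}, {a1, a2}, {a1, a2, a3}]] @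
     [cone_form a1 b1 a2 b2 a3 i j. i \<leftarrow> [0..<5], j \<leftarrow> [i..<5]]"

text \<open>The boolean says that the points contain a line. The last component is a set rather than
  a pair because the two cones are not ordered.\<close>

definition signature :: "triple \<Rightarrow> nat \<times> nat \<times> nat \<times> bool \<times> (nat \<times> nat) set" where
  "signature = (\<lambda>(S, \<P>, \<T>).
     (card \<P>, card S, card (S \<inter> \<Union>\<P>), \<exists>u\<in>S. \<exists>w\<in>S. u \<noteq> w \<and> u + w \<in> S,
      (\<lambda>T. (card (S \<inter> T), card {P \<in> \<P>. P \<subseteq> T})) ` \<T>))"

lemma length_normal_forms: "length (normal_forms a1 b1 a2 b2 a3 b3) = 43"
  by (simp add: normal_forms_def point_forms_def upt_rec)

lemma mem_span:
  "x \<in> span2 x y" "x \<in> span3 x y z" "x + z \<in> span3 x y z"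
  by (auto simp: span2_def span3_eq)

lemma not_mem_span2: "pairing x w = 1 \<Longrightarrow> pairing x y = 0 \<Longrightarrow> pairing x z = 0 \<Longrightarrow> w \<notin> span2 y z"
  by (auto simp: span2_def pairing_add_right)

lemma not_mem_span3:
  "pairing x w = 1 \<Longrightarrow> pairing x y = 0 \<Longrightarrow> pairing x z = 0 \<Longrightarrow> pairing x v = 0 \<Longrightarrow> w \<notin> span3 y z v"
  by (auto simp: span3_eq pairing_add_right)

lemma Collect_doubleton_conv_if:
  "{x. (x = y \<or> x = z) \<and> R x} = (if R y then {y} else {}) \<union> (if R z then {z} else {})"
  by auto

text \<open>Removing points or planes preserves configurations, so only the maximal normal
  forms have to be checked.\<close>

lemma configuration_mono:
  assumes "configuration S \<P> \<T>" "S' \<subseteq> S" "\<P>' \<subseteq> \<P>"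
  shows "configuration S' \<P>' \<T>"
proof -
  have cone: "cone_condition S' \<P>' v T" if "cone_condition S \<P> v T" for v T
    using that assms(2,3) unfolding cone_condition_def by blast
  have c: "0 \<notin> S" "isotropic S" "\<forall>P\<in>\<P>. hyperbolic_plane P \<and> S \<subseteq> P \<union> perp P"
      "\<forall>P\<in>\<P>. \<forall>Q\<in>\<P>. P \<noteq> Q \<longrightarrow> P \<subseteq> perp Q"
      "\<T> = {} \<or> (\<exists>v T. \<T> = {T, perp T} \<and> cone_condition S \<P> v T)"
    using assms(1) unfolding configuration_def by simp_all
  show ?thesis
    unfolding configuration_def
  proof (intro conjI)
    show "0 \<notin> S'" using c(1) assms(2) by blast
    show "isotropic S'" using c(2) assms(2) unfolding isotropic_def by blast
    show "\<forall>P\<in>\<P>'. hyperbolic_plane P \<and> S' \<subseteq> P \<union> perp P" using c(3) assms(2,3) by blast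
    show "\<forall>P\<in>\<P>'. \<forall>Q\<in>\<P>'. P \<noteq> Q \<longrightarrow> P \<subseteq> perp Q" using c(4) assms(3) by blast
    show "\<T> = {} \<or> (\<exists>v T. \<T> = {T, perp T} \<and> cone_condition S' \<P>' v T)" using c(5) cone by blast
  qed
qed

context
  fixes a1 b1 a2 b2 a3 b3
  assumes basis: "symplectic_basis a1 b1 a2 b2 a3 b3"
begin

lemma basis_pairing [simp]:
  "pairing a1 b1 = 1" "pairing a2 b2 = 1" "pairing a3 b3 = 1"
  "pairing a1 a2 = 0" "pairing a1 b2 = 0" "pairing a1 a3 = 0" "pairing a1 b3 = 0"
  "pairing b1 a2 = 0" "pairing b1 b2 = 0" "pairing b1 a3 = 0" "pairing b1 b3 = 0"
  "pairing a2 a3 = 0" "pairing a2 b3 = 0" "pairing b2 a3 = 0" "pairing b2 b3 = 0"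
  "pairing b1 a1 = 1" "pairing b2 a2 = 1" "pairing b3 a3 = 1"
  "pairing a2 a1 = 0" "pairing b2 a1 = 0" "pairing a3 a1 = 0" "pairing b3 a1 = 0"
  "pairing a2 b1 = 0" "pairing b2 b1 = 0" "pairing a3 b1 = 0" "pairing b3 b1 = 0"
  "pairing a3 a2 = 0" "pairing b3 a2 = 0" "pairing a3 b2 = 0" "pairing b3 b2 = 0"
  using basis by (simp_all add: pairing_commute symplectic_basis_def)

lemma basis_neq:
  "distinct [0, a1, a2, a3, a1 + a2, a1 + a3, a2 + a3, a1 + (a2 + a3)]"
proof -
  have "a1 \<noteq> 0" "a2 \<noteq> 0" "a3 \<noteq> 0" "a1 \<noteq> a2" "a1 \<noteq> a3" "a2 \<noteq> a3" "a1 + a2 \<noteq> a3"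
    using symplectic_basis_isotropic_triple [OF basis] by (auto simp: isotropic_triple_def)
  then show ?thesis by (auto simp: e3_simps e3_add_eq_iff)
qed

lemma basis_neqs [simp]:
  "a1 \<noteq> 0" "a2 \<noteq> 0" "a3 \<noteq> 0" "a1 \<noteq> a2" "a2 \<noteq> a1" "a1 \<noteq> a3" "a3 \<noteq> a1" "a2 \<noteq> a3" "a3 \<noteq> a2"
  "a1 + a2 \<noteq> a3" "a1 + a3 \<noteq> a2" "a2 + a3 \<noteq> a1" "a3 \<noteq> a1 + a2" "a2 \<noteq> a1 + a3" "a1 \<noteq> a2 + a3"
  using basis_neq by auto

lemma mem_span2 [simp]:
  "a1 \<in> span2 a1 b1" "a2 \<in> span2 a2 b2" "a3 \<in> span2 a3 b3"
  "a1 \<notin> span2 a2 b2" "a1 \<notin> span2 a3 b3" "a2 \<notin> span2 a1 b1" "a2 \<notin> span2 a3 b3"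
  "a3 \<notin> span2 a1 b1" "a3 \<notin> span2 a2 b2" "a2 + a3 \<notin> span2 a1 b1"
  "a1 + a3 \<notin> span2 a1 b1" "a2 + a3 \<notin> span2 a2 b2" "a1 + a3 \<notin> span2 a2 b2"
  using not_mem_span2 [of b1] not_mem_span2 [of b2] not_mem_span2 [of b3]
  by (simp_all add: mem_span pairing_add_right)

lemma mem_span3 [simp]:
  "a1 \<in> span3 a1 b1 a3" "a2 \<notin> span3 a1 b1 a3" "a1 + a3 \<in> span3 a1 b1 a3" "a2 + a3 \<notin> span3 a1 b1 a3"
  "a2 \<in> span3 a2 b2 a3" "a1 \<notin> span3 a2 b2 a3" "a2 + a3 \<in> span3 a2 b2 a3" "a1 + a3 \<notin> span3 a2 b2 a3"
  using not_mem_span3 [of b1] not_mem_span3 [of b2]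
  by (simp_all add: mem_span pairing_add_right)

lemma span2_neq [simp]:
  "span2 a1 b1 \<noteq> span2 a2 b2" "span2 a1 b1 \<noteq> span2 a3 b3" "span2 a2 b2 \<noteq> span2 a3 b3"
  "span2 a2 b2 \<noteq> span2 a1 b1" "span2 a3 b3 \<noteq> span2 a1 b1" "span2 a3 b3 \<noteq> span2 a2 b2"
  using mem_span2 by metis+

lemma span2_subset_span3 [simp]:
  "span2 a1 b1 \<subseteq> span3 a1 b1 a3" "span2 a2 b2 \<subseteq> span3 a2 b2 a3"
  "\<not> span2 a1 b1 \<subseteq> span3 a2 b2 a3" "\<not> span2 a2 b2 \<subseteq> span3 a1 b1 a3"
  using mem_span2(1,2) mem_span3(2,6) by (auto simp: span3_def simp del: mem_span3 mem_span2)

lemma map_signature_normal_forms: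
  "map signature (normal_forms a1 b1 a2 b2 a3 b3) =
     [(0, 0, 0, False, {}), (0, 1, 0, False, {}), (0, 2, 0, False, {}),
      (0, 3, 0, True, {}), (0, 3, 0, False, {}), (0, 4, 0, True, {}),
      (0, 4, 0, False, {}), (0, 5, 0, True, {}), (0, 6, 0, True, {}),
      (0, 7, 0, True, {}), (1, 0, 0, False, {}), (1, 1, 0, False, {}),
      (1, 2, 0, False, {}), (1, 3, 0, True, {}), (1, 1, 1, False, {}),
      (1, 2, 1, False, {}), (1, 3, 1, False, {}), (1, 4, 1, True, {}),
      (2, 0, 0, False, {}), (2, 1, 1, False, {}), (2, 2, 2, False, {}),
      (2, 1, 0, False, {}), (2, 2, 1, False, {}), (2, 3, 2, False, {}),
      (3, 0, 0, False, {}), (3, 1, 1, False, {}), (3, 2, 2, False, {}),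
      (3, 3, 3, False, {}), (0, 0, 0, False, {(0, 0)}),
      (0, 1, 0, False, {(0, 0), (1, 0)}), (0, 2, 0, False, {(0, 0), (2, 0)}),
      (1, 0, 0, False, {(0, 0), (0, 1)}), (1, 1, 1, False, {(0, 0), (1, 1)}),
      (0, 2, 0, False, {(1, 0)}), (0, 3, 0, False, {(1, 0), (2, 0)}),
      (1, 1, 0, False, {(1, 0), (0, 1)}), (1, 2, 1, False, {(1, 0), (1, 1)}),
      (0, 4, 0, False, {(2, 0)}), (1, 2, 0, False, {(2, 0), (0, 1)}),
      (1, 3, 1, False, {(2, 0), (1, 1)}), (2, 0, 0, False, {(0, 1)}),
      (2, 1, 1, False, {(0, 1), (1, 1)}), (2, 2, 2, False, {(1, 1)})]"
  by (simp add: normal_forms_def point_forms_def upt_rec cone_form_def side_forms_def)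
    (simp add: signature_def Collect_conv_if Collect_doubleton_conv_if Int_insert_left e3_simps
      numeral_2_eq_2)

lemma distinct_signatures: "distinct (map signature (normal_forms a1 b1 a2 b2 a3 b3))"
  unfolding map_signature_normal_forms by code_simp

lemma perp_span3_basis: "perp (span3 a1 b1 a3) = span3 a2 b2 a3"
proof -
  have c: "cone a3 (span3 a1 b1 a3)" "cone a3 (span3 a2 b2 a3)"
    by (simp_all add: cone_def) (metis basis_neqs(3) basis_pairing)+
  have "span3 a2 b2 a3 \<subseteq> perp (span3 a1 b1 a3)"
    by (rule span3_subset) (simp_all add: perp_span3)
  moreover have "card (perp (span3 a1 b1 a3)) = 8"
    using card_perp [OF subspace_span3, of a1 b1 a3] cone_card [OF c(1)] by simp
  ultimately show ?thesis using cone_card [OF c(2)] by (metis card_subset_eq finite_e3)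
qed

lemma hyperbolic_plane_basis:
  "hyperbolic_plane (span2 a1 b1)" "hyperbolic_plane (span2 a2 b2)" "hyperbolic_plane (span2 a3 b3)"
  unfolding hyperbolic_plane_def using basis_pairing(1,2,3) by blast+

lemma configuration_points:
  "configuration {a1, a2, a3, a1 + a2, a1 + a3, a2 + a3, a1 + (a2 + a3)} {} {}"
  using basis_neq by (auto simp: configuration_def isotropic_def pairing_linear)

lemma configuration_one_plane: "configuration {a1, a2, a3, a2 + a3} {span2 a1 b1} {}"
  using basis_neq hyperbolic_plane_basis
  by (auto simp: configuration_def isotropic_def pairing_linear perp_span2)

lemma configuration_three_planes:
  "configuration {a1, a2, a3} {span2 a1 b1, span2 a2 b2, span2 a3 b3} {}"
proof -
  have "span2 x y \<subseteq> perp (span2 z w)" if "pairing x z = 0" "pairing x w = 0" "pairing y z = 0" "pairing y w = 0" for x y z w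
    using that by (intro span2_subset) (simp_all add: perp_span2 pairing_commute)
  then show ?thesis
    using hyperbolic_plane_basis
    by (simp add: configuration_def isotropic_def perp_span2)
qed

lemma configuration_cone_form:
  assumes S: "S \<subseteq> {a1, a2, a1 + a3, a2 + a3}" and P: "\<P> \<subseteq> {span2 a1 b1, span2 a2 b2}"
    and SP: "span2 a1 b1 \<in> \<P> \<Longrightarrow> a1 + a3 \<notin> S" "span2 a2 b2 \<in> \<P> \<Longrightarrow> a2 + a3 \<notin> S"
  shows "configuration S \<P> {span3 a1 b1 a3, span3 a2 b2 a3}"
proof -
  have cone: "cone a3 (span3 a1 b1 a3)" "cone a3 (span3 a2 b2 a3)"
    by (simp_all add: cone_def) (metis basis_neqs(3) basis_pairing)+
  have "S \<subseteq> span3 a1 b1 a3 \<union> span3 a2 b2 a3"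
    using S mem_span3(1,3,5,7) by blast
  moreover have "a3 \<notin> S" using S by auto
  moreover have "\<forall>P\<in>\<P>. P \<subseteq> span3 a1 b1 a3 \<or> P \<subseteq> span3 a2 b2 a3"
    using P span2_subset_span3(1,2) by blast
  ultimately have cc: "cone_condition S \<P> a3 (span3 a1 b1 a3)"
    using cone by (simp add: cone_condition_def perp_span3_basis)
  have nz: "0 \<notin> S" using S basis_neq by auto
  have orth: "pairing u w = 0"
    if "u \<in> {a1, a2, a1 + a3, a2 + a3}" "w \<in> {a1, a2, a1 + a3, a2 + a3}" for u w
    using that by (auto simp: pairing_linear)
  have iso: "isotropic S"
    unfolding isotropic_def by (intro ballI orth subsetD [OF S])
  have PP: "span2 a1 b1 \<subseteq> perp (span2 a2 b2)" "span2 a2 b2 \<subseteq> perp (span2 a1 b1)"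
    by (rule span2_subset; simp add: perp_span2)+
  have S_P: "S \<subseteq> P \<union> perp P" if "P \<in> \<P>" for P
  proof -
    have "P = span2 a1 b1 \<or> P = span2 a2 b2" using that P by blast
    then show ?thesis
    proof
      assume "P = span2 a1 b1"
      then show ?thesis using S SP(1) that by (auto simp: perp_span2 pairing_linear)
    next
      assume "P = span2 a2 b2"
      then show ?thesis using S SP(2) that by (auto simp: perp_span2 pairing_linear)
    qed
  qed
  show ?thesis
    unfolding configuration_def perp_span3_basis [symmetric]
  proof (intro conjI ballI impI disjI2 exI)
    show "hyperbolic_plane Q" if "Q \<in> \<P>" for Q using that P hyperbolic_plane_basis by blast
    show "Q \<subseteq> perp R" if "Q \<in> \<P>" "R \<in> \<P>" "Q \<noteq> R" for Q R using that P PP by blast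
  qed (use nz iso S_P cc in simp_all)
qed

lemma normal_forms_configuration:
  assumes "(S, \<P>, \<T>) \<in> set (normal_forms a1 b1 a2 b2 a3 b3)"
  shows "configuration S \<P> \<T>"
proof -
  consider (1) "S \<in> set (point_forms a1 a2 a3)" "\<P> = {}" "\<T> = {}"
    | (2) "S \<subseteq> {a1, a2, a3, a2 + a3}" "\<P> = {span2 a1 b1}" "\<T> = {}"
    | (3) "S \<subseteq> {a1, a2, a3}" "\<P> \<subseteq> {span2 a1 b1, span2 a2 b2, span2 a3 b3}" "\<T> = {}"
    | (4) "\<exists>i j. i \<le> j \<and> j < 5 \<and> (S, \<P>, \<T>) = cone_form a1 b1 a2 b2 a3 i j"
    using assms by (auto simp: normal_forms_def) blast
  then show ?thesis
  proof cases
    case 1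
    then show ?thesis
      using configuration_mono [OF configuration_points] by (auto simp: point_forms_def)
  next
    case 2
    then show ?thesis using configuration_mono [OF configuration_one_plane] by blast
  next
    case 3
    then show ?thesis using configuration_mono [OF configuration_three_planes] by blast
  next
    case 4
    then obtain i j where ij: "i \<le> j" "j < 5" "(S, \<P>, \<T>) = cone_form a1 b1 a2 b2 a3 i j"
      by blast
    then have "i \<in> {0, 1, 2, 3, 4}" "j \<in> {0, 1, 2, 3, 4}" by auto
    then show ?thesis
      using ij(3) by (auto simp: cone_form_def side_forms_def e3_simps intro!: configuration_cone_form)
  qed
qed

end

declare basis_pairing [simp del] basis_neqs [simp del] mem_span2 [simp del] mem_span3 [simp del]
  span2_neq [simp del] span2_subset_span3 [simp del]

section \<open>Reduction of configurations to normal form\<close>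

lemma cone_orthogonal:
  assumes T: "cone v T" "a \<in> T" "b \<in> T" "pairing a b = 1"
    and w: "w \<in> T" "pairing a w = 0"
  shows "w \<in> {0, a, v, a + v}"
proof -
  have "v \<in> perp T" using cone_Int_perp [OF T(1)] by auto
  then have "pairing a v = 0" using T(2) by (simp add: perp_def)
  then show ?thesis
    using w T(4) unfolding cone_span3 [OF T] span3_eq by (auto simp: pairing_add_right)
qed

lemma cone_pair_orthogonal:
  assumes T: "cone v T" "a \<in> T" "b \<in> T" "pairing a b = 1"
    and w: "w \<in> T" "pairing a w = 0" "pairing b w = 0"
  shows "w \<in> {0, v}"
proof -
  have "v \<in> perp T" using cone_Int_perp [OF T(1)] by auto
  then have "pairing b v = 0" using T(3) by (simp add: perp_def)
  then show ?thesis
    using w(3) cone_orthogonal [OF T w(1,2)] T(4)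
    by (auto simp: pairing_add_right pairing_commute)
qed

text \<open>Distinct nonzero vectors of a hyperbolic plane are not orthogonal, so at most one point of a
  configuration lies in it; it is taken as first basis vector.\<close>

lemma hyperbolic_plane_isotropic_subset:
  assumes P: "hyperbolic_plane P" and S: "isotropic S" "0 \<notin> S"
  obtains a b where "pairing a b = 1" "P = span2 a b" "S \<inter> P \<subseteq> {a}"
proof (cases "S \<inter> P = {}")
  case True
  then show ?thesis using P that unfolding hyperbolic_plane_def by blast
next
  case False
  then obtain a where a: "a \<in> S" "a \<in> P" by blast
  then have "a \<notin> perp P" using hyperbolic_plane_Int_perp [OF P] S(2) by metis
  then obtain b where b: "b \<in> P" "pairing a b = 1" by (auto simp: perp_iff_pairing)
  have P_eq: "P = span2 a b" using hyperbolic_plane_span2 [OF P] a b by blast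
  have "u = a" if "u \<in> S" "u \<in> P" for u
  proof -
    have "pairing a u = 0" "u \<noteq> 0" using S a that by (auto simp: isotropic_def)
    then show ?thesis using that(2) b unfolding P_eq span2_def by (auto simp: pairing_add_right)
  qed
  then show ?thesis using that b(2) P_eq by blast
qed

text \<open>A point \<open>a\<close> of the cone is not the vertex, so it has a partner \<open>b\<close> in the cone, and the vectors
  of the cone orthogonal to \<open>a\<close> are \<open>0, a, v, a + v\<close>. If there is a plane instead, the vectors of the cone
  orthogonal to it are \<open>0\<close> and \<open>v\<close>; this leaves no room for a second plane or for a point
  outside the plane.\<close>

lemma cone_side_form:
  assumes T: "cone v T" and A: "A \<subseteq> T" "v \<notin> A" "0 \<notin> A" "isotropic A"
    and Q: "\<And>P. P \<in> \<Q> \<Longrightarrow> hyperbolic_plane P" "\<And>P. P \<in> \<Q> \<Longrightarrow> P \<subseteq> T"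
      "\<And>P. P \<in> \<Q> \<Longrightarrow> A \<subseteq> P \<union> perp P"
      "\<And>P P'. P \<in> \<Q> \<Longrightarrow> P' \<in> \<Q> \<Longrightarrow> P \<noteq> P' \<Longrightarrow> P' \<subseteq> perp P"
  obtains a b where "a \<in> T" "b \<in> T" "pairing a b = 1" "(A, \<Q>) \<in> set (side_forms a b v)"
proof (cases "\<Q> = {}")
  case True
  show ?thesis
  proof (cases "A = {}")
    case True
    obtain a b where "pairing a b = 1" "T = span3 a b v" using T by (auto simp: cone_def)
    moreover from this have "a \<in> T" "b \<in> T" by (auto simp: span3_eq)
    ultimately show ?thesis using that True \<open>\<Q> = {}\<close> by (auto simp: side_forms_def)
  next
    case False
    then obtain a where a: "a \<in> A" by blast
    then have "a \<noteq> v" "a \<noteq> 0" "a \<in> T" using A by auto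
    then have "a \<notin> perp T" using cone_Int_perp [OF T] by blast
    then obtain b where b: "b \<in> T" "pairing a b = 1" by (auto simp: perp_iff_pairing)
    have "u \<in> {a, a + v}" if "u \<in> A" for u
    proof -
      have "pairing a u = 0" using A(4) a that by (simp add: isotropic_def)
      then show ?thesis
        using cone_orthogonal [OF T \<open>a \<in> T\<close> b, of u] A that by auto
    qed
    then have "A = {a} \<or> A = {a, a + v}" using a by blast
    then show ?thesis using that [OF \<open>a \<in> T\<close> b] \<open>\<Q> = {}\<close> by (auto simp: side_forms_def)
  qed
next
  case False
  then obtain P where P: "P \<in> \<Q>" by blast
  obtain a b where ab: "pairing a b = 1" "P = span2 a b" "A \<inter> P \<subseteq> {a}"
    using hyperbolic_plane_isotropic_subset [OF Q(1) [OF P] A(4,3)] by blast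
  then have mem: "a \<in> T" "b \<in> T" using Q(2) [OF P] by (auto simp: span2_def)
  have rad: "w \<in> {0, v}" if "w \<in> T" "w \<in> perp P" for w
    using that cone_pair_orthogonal [OF T mem ab(1)] unfolding ab(2) perp_span2 by blast
  have "\<Q> = {P}"
  proof (rule ccontr)
    assume "\<Q> \<noteq> {P}"
    then obtain P' where P': "P' \<in> \<Q>" "P \<noteq> P'" using P by blast
    then obtain x y where xy: "pairing x y = 1" "x \<in> P'" "y \<in> P'"
      using Q(1) [OF P'(1)] by (auto simp: hyperbolic_plane_def span2_def)
    then have "x \<in> {0, v}" "y \<in> {0, v}"
      using rad Q(2) [OF P'(1)] Q(4) [OF P P'] by blast+
    then show False using xy(1) by auto
  qed
  moreover have "A \<subseteq> P" using rad Q(3) [OF P] A(1,2,3) by blast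
  then have "A = {} \<or> A = {a}" using ab(3) by blast
  ultimately show ?thesis using that [OF mem ab(1)] ab(2) by (auto simp: side_forms_def)
qed

definition normalizable :: "triple \<Rightarrow> bool" where
  "normalizable t \<longleftrightarrow> (\<exists>a1 b1 a2 b2 a3 b3.
     symplectic_basis a1 b1 a2 b2 a3 b3 \<and> t \<in> set (normal_forms a1 b1 a2 b2 a3 b3))"

lemma normalizableI:
  "symplectic_basis a1 b1 a2 b2 a3 b3 \<Longrightarrow> t \<in> set (normal_forms a1 b1 a2 b2 a3 b3) \<Longrightarrow> normalizable t"
  unfolding normalizable_def by blast

lemma point_form_normal_form:
  "S \<in> set (point_forms a1 a2 a3) \<Longrightarrow> (S, {}, {}) \<in> set (normal_forms a1 b1 a2 b2 a3 b3)"
  by (simp add: normal_forms_def)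

lemma one_plane_normal_form:
  assumes "S \<in> {{}, {a1}}" "S' \<in> {{}, {a2}, {a2, a3}, {a2, a3, a2 + a3}}"
  shows "(S \<union> S', {span2 a1 b1}, {}) \<in> set (normal_forms a1 b1 a2 b2 a3 b3)"
proof -
  have "(S \<union> S', {span2 a1 b1}, {}) \<in> set [(S \<union> S', {span2 a1 b1}, {}).
      S \<leftarrow> [{}, {a1}], S' \<leftarrow> [{}, {a2}, {a2, a3}, {a2, a3, a2 + a3}]]"
    using assms by (elim insertE emptyE) simp_all
  then show ?thesis unfolding normal_forms_def set_append Un_iff by (rule disjI2 [OF disjI1])
qed

lemma two_planes_normal_form:
  assumes "S \<in> {{}, {a1}, {a1, a2}, {a3}, {a1, a3}, {a1, a2, a3}}"
  shows "(S, {span2 a1 b1, span2 a2 b2}, {}) \<in> set (normal_forms a1 b1 a2 b2 a3 b3)"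
proof -
  have "(S, {span2 a1 b1, span2 a2 b2}, {}) \<in> set [(S, {span2 a1 b1, span2 a2 b2}, {}).
      S \<leftarrow> [{}, {a1}, {a1, a2}, {a3}, {a1, a3}, {a1, a2, a3}]]"
    unfolding set_map list.set using assms by (rule imageI)
  then show ?thesis unfolding normal_forms_def set_append Un_iff by (rule disjI2 [OF disjI2 [OF disjI1]])
qed

lemma three_planes_normal_form:
  assumes "S \<in> {{}, {a1}, {a1, a2}, {a1, a2, a3}}"
  shows "(S, {span2 a1 b1, span2 a2 b2, span2 a3 b3}, {}) \<in> set (normal_forms a1 b1 a2 b2 a3 b3)"
proof -
  have "(S, {span2 a1 b1, span2 a2 b2, span2 a3 b3}, {}) \<in>
      set [(S, {span2 a1 b1, span2 a2 b2, span2 a3 b3}, {}). S \<leftarrow> [{}, {a1}, {a1, a2}, {a1, a2, a3}]]"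
    unfolding set_map list.set using assms by (rule imageI)
  then show ?thesis unfolding normal_forms_def set_append Un_iff by (rule disjI2 [OF disjI2 [OF disjI2 [OF disjI1]]])
qed

lemma cone_form_normal_form:
  assumes "i \<le> j" "j < 5"
  shows "cone_form a1 b1 a2 b2 a3 i j \<in> set (normal_forms a1 b1 a2 b2 a3 b3)"
proof -
  have "cone_form a1 b1 a2 b2 a3 i j \<in> set [cone_form a1 b1 a2 b2 a3 i j. i \<leftarrow> [0..<5], j \<leftarrow> [i..<5]]"
    using assms by (auto intro!: bexI [of _ i])
  then show ?thesis unfolding normal_forms_def set_append Un_iff by (rule disjI2 [OF disjI2 [OF disjI2 [OF disjI2]]])
qed

lemma cone_form_commute:
  "cone_form a2 b2 a1 b1 v j i = cone_form a1 b1 a2 b2 v i j"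
  by (simp add: cone_form_def Un_commute insert_commute)

text \<open>The two sides are normalized independently, as \<open>T\<close> and \<open>T\<^sup>\<bottom>\<close> are orthogonal. Their bases and the
  common vertex lack only the vector dual to the vertex. Exchanging the sides puts the two
  indices into increasing order.\<close>

lemma normalizable_cone:
  assumes c: "configuration S \<P> \<T>" and cc: "cone_condition S \<P> v T" and TT: "\<T> = {T, perp T}"
  shows "normalizable (S, \<P>, \<T>)"
proof -
  have cones: "cone v T" "cone v (perp T)" and S: "v \<notin> S" "S \<subseteq> T \<union> perp T"
    and P: "\<And>P. P \<in> \<P> \<Longrightarrow> P \<subseteq> T \<or> P \<subseteq> perp T"
    using cc by (simp_all add: cone_condition_def)
  have nz: "0 \<notin> S" and iso: "isotropic S"
    and hyp: "\<And>P. P \<in> \<P> \<Longrightarrow> hyperbolic_plane P"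
    and SP: "\<And>P. P \<in> \<P> \<Longrightarrow> S \<subseteq> P \<union> perp P"
    and PP: "\<And>P Q. P \<in> \<P> \<Longrightarrow> Q \<in> \<P> \<Longrightarrow> P \<noteq> Q \<Longrightarrow> P \<subseteq> perp Q"
    using c unfolding configuration_def by simp_all
  have side: "\<exists>a b i. a \<in> X \<and> b \<in> X \<and> pairing a b = 1 \<and> i < 5 \<and>
      side_forms a b v ! i = (S \<inter> X, {P \<in> \<P>. P \<subseteq> X})" if X: "cone v X" for X
  proof -
    have "isotropic (S \<inter> X)" using iso by (simp add: isotropic_def)
    then obtain a b where "a \<in> X" "b \<in> X" "pairing a b = 1"
      "(S \<inter> X, {P \<in> \<P>. P \<subseteq> X}) \<in> set (side_forms a b v)"
      using cone_side_form [OF X, of "S \<inter> X" "{P \<in> \<P>. P \<subseteq> X}"] S nz hyp SP PP by blast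
    moreover have "length (side_forms a b v) = 5" by (simp add: side_forms_def)
    ultimately show ?thesis unfolding in_set_conv_nth by metis
  qed
  obtain a1 b1 i where 1: "a1 \<in> T" "b1 \<in> T" "pairing a1 b1 = 1" "i < 5"
    "side_forms a1 b1 v ! i = (S \<inter> T, {P \<in> \<P>. P \<subseteq> T})"
    using side [OF cones(1)] by blast
  obtain a2 b2 j where 2: "a2 \<in> perp T" "b2 \<in> perp T" "pairing a2 b2 = 1" "j < 5"
    "side_forms a2 b2 v ! j = (S \<inter> perp T, {P \<in> \<P>. P \<subseteq> perp T})"
    using side [OF cones(2)] by blast
  have v: "v \<in> T" "v \<in> perp T" "v \<noteq> 0"
    using cone_Int_perp [OF cones(1)] cones(1) by (auto simp: cone_def)
  have orth: "pairing x y = 0" "pairing y x = 0" if "x \<in> T" "y \<in> perp T" for x y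
    using that pairing_commute [of x y] by (simp_all add: perp_def)
  note pairings = 1(3) 2(3) orth [OF 1(1) 2(1)] orth [OF 1(1) 2(2)] orth [OF 1(2) 2(1)]
    orth [OF 1(2) 2(2)] orth [OF 1(1) v(2)] orth [OF 1(2) v(2)] orth [OF v(1) 2(1)] orth [OF v(1) 2(2)]
  have "isotropic_triple a1 a2 v"
    by (rule orthogonal_pairs_isotropic_triple [of a1 b1 a2 b2]) (fact pairings v)+
  then obtain b3 where basis: "symplectic_basis a1 b1 a2 b2 v b3"
    using extend_b3 [of a1 a2 v b1 b2] pairings by blast
  have "S = (S \<inter> T) \<union> (S \<inter> perp T)" using S by blast
  moreover have "\<P> = {P \<in> \<P>. P \<subseteq> T} \<union> {P \<in> \<P>. P \<subseteq> perp T}" using P by blast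
  moreover have "\<T> = {span3 a1 b1 v, span3 a2 b2 v}"
    using TT cone_span3 [OF cones(1) 1(1-3)] cone_span3 [OF cones(2) 2(1-3)] by simp
  ultimately have form: "(S, \<P>, \<T>) = cone_form a1 b1 a2 b2 v i j"
    by (simp add: cone_form_def 1(5) 2(5))
  show ?thesis
  proof (cases "i \<le> j")
    case True
    then show ?thesis
      unfolding form by (intro normalizableI [OF basis] cone_form_normal_form 2(4))
  next
    case False
    then have "j \<le> i" by simp
    then show ?thesis
      unfolding form cone_form_commute [of a1 b1 a2 b2 v i j]
      by (intro normalizableI [OF symplectic_basis_swap12 [OF basis]] cone_form_normal_form 1(4))
  qed
qed

text \<open>The sixteen sets of points between a basis and the whole Fano plane, each with a basis that
  exhibits its form. For instance, a set that misses two points contains the third point of the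
  line through them, and this point must become \<open>a\<^sub>1\<close> in the form with five points.\<close>

lemma point_forms_spanning:
  assumes t: "isotropic_triple x y z" and S: "x \<in> S" "y \<in> S" "z \<in> S"
    "S \<subseteq> {x, y, z, x + y, x + z, y + z, x + (y + z)}"
  shows "\<exists>a1 a2 a3. isotropic_triple a1 a2 a3 \<and> S \<in> set (point_forms a1 a2 a3)"
proof -
  have ne: "x \<noteq> 0" "y \<noteq> 0" "z \<noteq> 0" "x \<noteq> y" "x \<noteq> z" "y \<noteq> z" "x + y \<noteq> z" "x + z \<noteq> y" "y + z \<noteq> x"
    and p: "pairing x y = 0" "pairing x z = 0" "pairing y z = 0"
      "pairing y x = 0" "pairing z x = 0" "pairing z y = 0"
    using t by (auto simp: isotropic_triple_def pairing_commute e3_simps e3_add_eq_iff)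
  let ?bases = "[(x, y, z), (x, z, y), (y, z, x), (y, x, z), (z, x, y), (x + y, x, z), (x + z, x, y),
    (y + z, y, x), (x, y, x + z), (x, y, y + z), (x, z, y + z)]"
  have bases: "\<forall>(a1, a2, a3) \<in> set ?bases. isotropic_triple a1 a2 a3"
    using ne ne [symmetric]
    by (simp add: isotropic_triple_def pairing_add_left pairing_add_right p e3_simps e3_add_eq_iff)
  obtain q1 q2 q3 q4 where S_eq: "S = {x, y, z} \<union> (if q1 then {x + y} else {})
      \<union> (if q2 then {x + z} else {}) \<union> (if q3 then {y + z} else {})
      \<union> (if q4 then {x + (y + z)} else {})"
    using S by (intro that [of "x + y \<in> S" "x + z \<in> S" "y + z \<in> S" "x + (y + z) \<in> S"]) auto
  have "\<exists>(a1, a2, a3) \<in> set ?bases. S \<in> set (point_forms a1 a2 a3)"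
    unfolding S_eq
    by (cases q1; cases q2; cases q3; cases q4)
      (simp_all add: point_forms_def e3_simps insert_commute)
  then show ?thesis using bases by blast
qed

text \<open>Three independent points of \<open>S\<close> span a Lagrangian subspace, which contains all others
  by maximality. If there are no three, then \<open>S\<close> is contained in a line.\<close>

lemma normalizable_points:
  assumes iso: "isotropic S" and nz: "0 \<notin> S"
  shows "normalizable (S, {}, {})"
proof -
  have iso': "pairing u w = 0" if "u \<in> S" "w \<in> S" for u w
    using iso that by (simp add: isotropic_def)
  have "\<exists>a1 a2 a3. isotropic_triple a1 a2 a3 \<and> S \<in> set (point_forms a1 a2 a3)"
  proof (cases "S = {}")
    case True
    then show ?thesis
      using exists_symplectic_basis symplectic_basis_isotropic_triple
      by (fastforce simp: point_forms_def)
  next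
    case False
    then obtain x where x: "x \<in> S" "x \<noteq> 0" using nz by blast
    show ?thesis
    proof (cases "S = {x}")
      case True
      obtain x' where "pairing x x' = 1" using x(2) by (rule pairing_nondegenerate)
      then obtain y where "y \<noteq> 0" "y \<noteq> x" "pairing x y = 0" using extend_a2 by blast
      then obtain z where "isotropic_triple x y z" using extend_a3 [of x y] x(2) by blast
      then show ?thesis using True by (auto simp: point_forms_def)
    next
      case False
      then obtain y where y: "y \<in> S" "y \<noteq> 0" "y \<noteq> x" using x nz by blast
      show ?thesis
      proof (cases "S \<subseteq> {x, y, x + y}")
        case True
        obtain z where "isotropic_triple x y z"
          using extend_a3 [of x y] x y iso' by blast
        moreover have "S = {x, y} \<or> S = {x, y, x + y}" using True x y by blast
        ultimately show ?thesis by (auto simp: point_forms_def)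
      next
        case False
        then obtain z where z: "z \<in> S" "z \<noteq> x" "z \<noteq> y" "z \<noteq> x + y" by blast
        then have t: "isotropic_triple x y z"
          using x y iso' nz by (auto simp: isotropic_triple_def)
        have "u \<in> {x, y, z, x + y, x + z, y + z, x + (y + z)}" if "u \<in> S" for u
        proof -
          have "u \<in> span3 x y z"
            by (intro isotropic_triple_maximal t iso' x y z that)
          moreover have "u \<noteq> 0" using nz that by blast
          ultimately show ?thesis unfolding span3_eq by blast
        qed
        then show ?thesis using point_forms_spanning [OF t x(1) y(1) z(1)] by blast
      qed
    qed
  qed
  then obtain a1 a2 a3 where "isotropic_triple a1 a2 a3" "S \<in> set (point_forms a1 a2 a3)" by blast
  then show ?thesis
    using extend_b1_b2_b3 point_form_normal_form normalizableI by metis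
qed

lemma extend_a3_perp_b1:
  assumes a: "a1 \<noteq> 0" "a2 \<noteq> 0" "a1 \<noteq> a2" "pairing a1 a2 = 0" and b1: "pairing a1 b1 = 1" "pairing b1 a2 = 0"
  shows "\<exists>a3. isotropic_triple a1 a2 a3 \<and> pairing b1 a3 = 0"
proof -
  obtain z where z: "isotropic_triple a1 a2 z" using extend_a3 [OF a] by blast
  define a3 where "a3 = z + scale_e3 (pairing b1 z) a1"
  have "pairing b1 a1 = 1" using b1 by (simp add: pairing_commute)
  then have "pairing b1 a3 = 0" by (simp add: a3_def pairing_linear)
  moreover have "isotropic_triple a1 a2 (z + a1)"
    using z by (auto simp: isotropic_triple_def pairing_add_right pairing_commute e3_simps e3_add_eq_iff)
  then have "isotropic_triple a1 a2 a3" using z by (simp add: a3_def scale_e3_def)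
  ultimately show ?thesis by blast
qed

text \<open>The points outside \<open>P\<close> are orthogonal to \<open>a\<^sub>1\<close> and \<open>b\<^sub>1\<close>. Two of them form an isotropic
  triple with \<open>a\<^sub>1\<close>, and a further one lies in the span of this triple; pairing with \<open>b\<^sub>1\<close> shows that
  \<open>a\<^sub>1\<close> does not occur in it.\<close>

lemma normalizable_one_plane:
  assumes c: "configuration S {P} {}"
  shows "normalizable (S, {P}, {})"
proof -
  have nz: "0 \<notin> S" and iso: "isotropic S" and P: "hyperbolic_plane P" and SP: "S \<subseteq> P \<union> perp P"
    using c by (simp_all add: configuration_def)
  have iso': "pairing u w = 0" if "u \<in> S" "w \<in> S" for u w
    using iso that by (simp add: isotropic_def)
  obtain a1 b1 where ab: "pairing a1 b1 = 1" "P = span2 a1 b1" "S \<inter> P \<subseteq> {a1}"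
    using hyperbolic_plane_isotropic_subset [OF P iso nz] by blast
  have perp: "pairing a1 u = 0" "pairing b1 u = 0" if "u \<in> S - P" for u
  proof -
    have "u \<in> perp (span2 a1 b1)" using that SP ab(2) by blast
    then show "pairing a1 u = 0" "pairing b1 u = 0" by (simp_all add: perp_span2)
  qed
  have a1: "a1 \<noteq> 0" "a1 \<noteq> u" if "pairing b1 u = 0" for u
    using ab(1) that by (auto simp: pairing_commute)
  have a1_add: "a1 + u \<noteq> w" if "pairing b1 u = 0" "pairing b1 w = 0" for u w
    using ab(1) that by (auto simp: pairing_add_right pairing_commute)
  have "\<exists>a2 a3. isotropic_triple a1 a2 a3 \<and> pairing b1 a2 = 0 \<and> pairing b1 a3 = 0 \<and>
    S - P \<in> {{}, {a2}, {a2, a3}, {a2, a3, a2 + a3}}"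
  proof (cases "S - P = {}")
    case True
    obtain a2 where "a2 \<noteq> 0" "a2 \<noteq> a1" "pairing a1 a2 = 0" "pairing b1 a2 = 0"
      using extend_a2 [OF ab(1)] by blast
    moreover from this obtain a3 where "isotropic_triple a1 a2 a3" "pairing b1 a3 = 0"
      using extend_a3_perp_b1 [of a1 a2 b1] ab(1) a1 by blast
    ultimately show ?thesis using True by blast
  next
    case False
    then obtain x where x: "x \<in> S - P" by blast
    have x0: "x \<noteq> 0" using x nz by blast
    show ?thesis
    proof (cases "S - P = {x}")
      case True
      obtain a3 where "isotropic_triple a1 x a3" "pairing b1 a3 = 0"
        using extend_a3_perp_b1 [of a1 x b1] ab(1) a1 perp [OF x] x0 by blast
      then show ?thesis using True perp [OF x] by blast
    next
      case False
      then obtain y where y: "y \<in> S - P" "y \<noteq> x" using x by blast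
      have y0: "y \<noteq> 0" using y nz by blast
      have t: "isotropic_triple a1 x y"
        using perp [OF x] perp [OF y(1)] a1 a1_add iso' x y x0 y0
        by (auto simp: isotropic_triple_def)
      have "u \<in> {x, y, x + y}" if u: "u \<in> S - P" for u
      proof -
        have "u \<in> span3 a1 x y"
          by (intro isotropic_triple_maximal t) (use perp [OF u] iso' x y u in auto)
        moreover have "u \<noteq> 0" using nz u by blast
        moreover have "pairing b1 a1 = 1" using ab(1) by (simp add: pairing_commute)
        ultimately show ?thesis
          using perp(2) [OF u] perp(2) [OF x] perp(2) [OF y(1)] unfolding span3_eq
          by (auto simp: pairing_add_right)
      qed
      then have "S - P = {x, y} \<or> S - P = {x, y, x + y}" using x y by blast
      then show ?thesis using t perp(2) [OF x] perp(2) [OF y(1)] by blast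
    qed
  qed
  then obtain a2 a3 where a: "isotropic_triple a1 a2 a3" "pairing b1 a2 = 0" "pairing b1 a3 = 0"
    "S - P \<in> {{}, {a2}, {a2, a3}, {a2, a3, a2 + a3}}" by blast
  obtain b2 b3 where basis: "symplectic_basis a1 b1 a2 b2 a3 b3"
    using extend_b2_b3 [OF a(1) ab(1)] a(2,3) by (auto simp: pairing_commute)
  have "S \<inter> P \<in> {{}, {a1}}" using ab(3) by blast
  then have "((S \<inter> P) \<union> (S - P), {P}, {}) \<in> set (normal_forms a1 b1 a2 b2 a3 b3)"
    unfolding ab(2) using a(4) by (intro one_plane_normal_form) (simp_all only: ab(2))
  moreover have "(S \<inter> P) \<union> (S - P) = S" by blast
  ultimately show ?thesis using normalizableI [OF basis] by simp
qed

lemma subset_triple: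
  assumes "X \<subseteq> {a, b, c}"
  shows "X \<in> {{}, {a}, {b}, {c}, {a, b}, {a, c}, {b, c}, {a, b, c}}"
proof -
  obtain p q r where X: "X = (if p then {a} else {}) \<union> (if q then {b} else {}) \<union> (if r then {c} else {})"
    using assms by (intro that [of "a \<in> X" "b \<in> X" "c \<in> X"]) auto
  show ?thesis
    unfolding X by (cases p; cases q; cases r) (simp_all add: insert_commute)
qed

lemma orthogonal_hyperbolic_planes:
  assumes "P \<subseteq> perp Q" "P = span2 a1 b1" "Q = span2 a2 b2"
  shows "pairing a1 a2 = 0" "pairing a1 b2 = 0" "pairing b1 a2 = 0" "pairing b1 b2 = 0"
proof -
  have "a1 \<in> perp (span2 a2 b2)" "b1 \<in> perp (span2 a2 b2)"
    using assms mem_span(1) by (auto simp: span2_def)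
  then show "pairing a1 a2 = 0" "pairing a1 b2 = 0" "pairing b1 a2 = 0" "pairing b1 b2 = 0"
    by (simp_all add: perp_span2 pairing_commute)
qed

text \<open>The complement of both planes is again a hyperbolic plane, so it contains at most one point,
  which becomes \<open>a\<^sub>3\<close>. Swapping the planes treats the case in which only the second contains a point.\<close>

lemma normalizable_two_planes:
  assumes c: "configuration S {P, Q} {}" and PQ: "P \<noteq> Q"
  shows "normalizable (S, {P, Q}, {})"
proof -
  have nz: "0 \<notin> S" and iso: "isotropic S" and P: "hyperbolic_plane P" and Q: "hyperbolic_plane Q"
    and SP: "S \<subseteq> P \<union> perp P" "S \<subseteq> Q \<union> perp Q" and perp_PQ: "P \<subseteq> perp Q"
    using c PQ by (simp_all add: configuration_def)
  obtain a1 b1 where 1: "pairing a1 b1 = 1" "P = span2 a1 b1" "S \<inter> P \<subseteq> {a1}"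
    using hyperbolic_plane_isotropic_subset [OF P iso nz] by blast
  obtain a2 b2 where 2: "pairing a2 b2 = 1" "Q = span2 a2 b2" "S \<inter> Q \<subseteq> {a2}"
    using hyperbolic_plane_isotropic_subset [OF Q iso nz] by blast
  note orth = 1(1) 2(1) orthogonal_hyperbolic_planes [OF perp_PQ 1(2) 2(2)]
  define R where "R = S \<inter> perp P \<inter> perp Q"
  have R: "u \<noteq> 0" "pairing a1 u = 0" "pairing b1 u = 0" "pairing a2 u = 0" "pairing b2 u = 0" if "u \<in> R" for u
  proof -
    have "u \<in> perp (span2 a1 b1)" "u \<in> perp (span2 a2 b2)" using that 1(2) 2(2) by (auto simp: R_def)
    then show "pairing a1 u = 0" "pairing b1 u = 0" "pairing a2 u = 0" "pairing b2 u = 0"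
      by (simp_all add: perp_span2)
    show "u \<noteq> 0" using that nz by (auto simp: R_def)
  qed
  have "\<exists>a3. isotropic_triple a1 a2 a3 \<and> pairing b1 a3 = 0 \<and> pairing b2 a3 = 0 \<and> R \<subseteq> {a3}"
  proof (cases "R = {}")
    case True
    obtain a3 where a3: "a3 \<noteq> 0" "pairing a1 a3 = 0" "pairing b1 a3 = 0" "pairing a2 a3 = 0" "pairing b2 a3 = 0"
      using extend_a3_orthogonal [OF orth] by blast
    then show ?thesis using orthogonal_pairs_isotropic_triple [OF orth a3] True by blast
  next
    case False
    then obtain a3 where a3: "a3 \<in> R" by blast
    have t: "isotropic_triple a1 a2 a3" by (rule orthogonal_pairs_isotropic_triple [OF orth R [OF a3]])
    have "u = a3" if "u \<in> R" for u
    proof -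
      have "pairing a3 u = 0" using a3 that iso by (auto simp: R_def isotropic_def)
      then have "u \<in> span3 a1 a2 a3" using isotropic_triple_maximal [OF t] R [OF that] by blast
      moreover have "pairing b1 a1 = 1" "pairing b2 a2 = 1" "pairing b2 a1 = 0"
        using orth by (simp_all add: pairing_commute)
      ultimately show ?thesis
        using R [OF that] R [OF a3] orth unfolding span3_eq by (auto simp: pairing_add_right)
    qed
    then show ?thesis using t R [OF a3] by blast
  qed
  then obtain a3 where a3: "isotropic_triple a1 a2 a3" "pairing b1 a3 = 0" "pairing b2 a3 = 0" "R \<subseteq> {a3}"
    by blast
  have "pairing a2 b1 = 0" "pairing a3 b1 = 0" "pairing a3 b2 = 0"
    using orth a3 by (simp_all add: pairing_commute)
  then obtain b3 where basis: "symplectic_basis a1 b1 a2 b2 a3 b3"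
    using extend_b3 [OF a3(1)] orth by blast
  have "u \<in> {a1, a2, a3}" if "u \<in> S" for u
  proof -
    have "u \<in> P \<or> u \<in> Q \<or> u \<in> R" using SP that by (auto simp: R_def)
    then show ?thesis using 1(3) 2(3) a3(4) that by blast
  qed
  then have "S \<subseteq> {a1, a2, a3}" by blast
  from subset_triple [OF this] have "S \<in> {{}, {a1}, {a1, a2}, {a3}, {a1, a3}, {a1, a2, a3}} \<or>
      S \<in> {{}, {a2}, {a2, a1}, {a3}, {a2, a3}, {a2, a1, a3}}"
    by (elim insertE emptyE) (simp_all add: insert_commute)
  then show ?thesis
  proof
    assume "S \<in> {{}, {a1}, {a1, a2}, {a3}, {a1, a3}, {a1, a2, a3}}"
    then show ?thesis
      unfolding 1(2) 2(2) by (intro normalizableI [OF basis] two_planes_normal_form)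
  next
    assume "S \<in> {{}, {a2}, {a2, a1}, {a3}, {a2, a3}, {a2, a1, a3}}"
    then show ?thesis
      unfolding 1(2) 2(2) insert_commute [of "span2 a1 b1"]
      by (intro normalizableI [OF symplectic_basis_swap12 [OF basis]] two_planes_normal_form)
  qed
qed

lemma symplectic_basis_rotate:
  assumes "symplectic_basis a1 b1 a2 b2 a3 b3"
  shows "symplectic_basis a2 b2 a3 b3 a1 b1"
  by (simp add: symplectic_basis_def basis_pairing [OF assms])

lemma symplectic_basis_perp_planes:
  assumes "symplectic_basis a1 b1 a2 b2 a3 b3"
    and "w \<in> perp (span2 a1 b1)" "w \<in> perp (span2 a2 b2)" "w \<in> perp (span2 a3 b3)"
  shows "w = 0"
  using symplectic_basis_perp [OF assms(1)] assms(2-) by (simp add: perp_span2)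

text \<open>Three orthogonal hyperbolic planes fill the space: nothing but \<open>0\<close> is orthogonal to all of
  them. Hence there is no fourth plane and every point lies in one of the three.\<close>

lemma normalizable_three_planes:
  assumes c: "configuration S \<P> {}" and mem: "P \<in> \<P>" "Q \<in> \<P>" "R \<in> \<P>"
    and ne: "P \<noteq> Q" "P \<noteq> R" "Q \<noteq> R"
  shows "normalizable (S, \<P>, {})"
proof -
  have nz: "0 \<notin> S" and iso: "isotropic S"
    and hyp: "\<And>P. P \<in> \<P> \<Longrightarrow> hyperbolic_plane P"
    and SP: "\<And>P. P \<in> \<P> \<Longrightarrow> S \<subseteq> P \<union> perp P"
    and PP: "\<And>P Q. P \<in> \<P> \<Longrightarrow> Q \<in> \<P> \<Longrightarrow> P \<noteq> Q \<Longrightarrow> P \<subseteq> perp Q"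
    using c unfolding configuration_def by simp_all
  obtain a1 b1 where 1: "pairing a1 b1 = 1" "P = span2 a1 b1" "S \<inter> P \<subseteq> {a1}"
    using hyperbolic_plane_isotropic_subset [OF hyp [OF mem(1)] iso nz] by blast
  obtain a2 b2 where 2: "pairing a2 b2 = 1" "Q = span2 a2 b2" "S \<inter> Q \<subseteq> {a2}"
    using hyperbolic_plane_isotropic_subset [OF hyp [OF mem(2)] iso nz] by blast
  obtain a3 b3 where 3: "pairing a3 b3 = 1" "R = span2 a3 b3" "S \<inter> R \<subseteq> {a3}"
    using hyperbolic_plane_isotropic_subset [OF hyp [OF mem(3)] iso nz] by blast
  have basis: "symplectic_basis a1 b1 a2 b2 a3 b3"
    unfolding symplectic_basis_def
    by (intro conjI 1(1) 2(1) 3(1)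
      orthogonal_hyperbolic_planes [OF PP [OF mem(1,2) ne(1)] 1(2) 2(2)]
      orthogonal_hyperbolic_planes [OF PP [OF mem(1,3) ne(2)] 1(2) 3(2)]
      orthogonal_hyperbolic_planes [OF PP [OF mem(2,3) ne(3)] 2(2) 3(2)])
  have perp_0: "w = 0" if "w \<in> perp P" "w \<in> perp Q" "w \<in> perp R" for w
    using symplectic_basis_perp_planes [OF basis] that 1(2) 2(2) 3(2) by simp
  have "P' \<in> {P, Q, R}" if P': "P' \<in> \<P>" for P'
  proof (rule ccontr)
    assume "P' \<notin> {P, Q, R}"
    then have "P' \<subseteq> perp P" "P' \<subseteq> perp Q" "P' \<subseteq> perp R" using PP P' mem by blast+
    then have "P' \<subseteq> {0}" using perp_0 by blast
    then have "card P' \<le> 1" using card_mono [of "{0}" P'] by simp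
    then show False using hyperbolic_plane_card [OF hyp [OF P']] by simp
  qed
  then have \<P>: "\<P> = {span2 a1 b1, span2 a2 b2, span2 a3 b3}"
    using mem unfolding 1(2) 2(2) 3(2) by blast
  have "u \<in> {a1, a2, a3}" if "u \<in> S" for u
  proof -
    have "u \<noteq> 0" using nz that by blast
    then have "u \<in> P \<or> u \<in> Q \<or> u \<in> R"
      using SP [OF mem(1)] SP [OF mem(2)] SP [OF mem(3)] perp_0 [of u] that by blast
    then show ?thesis using 1(3) 2(3) 3(3) that by blast
  qed
  then have S: "S \<subseteq> {a1, a2, a3}" by blast
  have normal: ?thesis
    if "symplectic_basis x1 y1 x2 y2 x3 y3" "S \<in> {{}, {x1}, {x1, x2}, {x1, x2, x3}}"
      "\<P> = {span2 x1 y1, span2 x2 y2, span2 x3 y3}" for x1 y1 x2 y2 x3 y3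
    unfolding that(3) by (intro normalizableI [OF that(1)] three_planes_normal_form that(2))
  have "S \<in> {{}, {a1}, {a1, a2}, {a1, a2, a3}} \<or> S \<in> {{}, {a2}, {a2, a3}, {a2, a3, a1}} \<or>
      S \<in> {{}, {a3}, {a3, a1}, {a3, a1, a2}}"
    using subset_triple [OF S] by (elim insertE emptyE) (simp_all add: insert_commute)
  then show ?thesis
  proof (elim disjE)
    assume "S \<in> {{}, {a1}, {a1, a2}, {a1, a2, a3}}"
    then show ?thesis by (rule normal [OF basis _ \<P>])
  next
    assume "S \<in> {{}, {a2}, {a2, a3}, {a2, a3, a1}}"
    then show ?thesis
      by (rule normal [OF symplectic_basis_rotate [OF basis]]) (auto simp: \<P>)
  next
    assume "S \<in> {{}, {a3}, {a3, a1}, {a3, a1, a2}}"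
    then show ?thesis
      by (rule normal [OF symplectic_basis_rotate [OF symplectic_basis_rotate [OF basis]]]) (auto simp: \<P>)
  qed
qed

lemma configuration_normalizable:
  assumes c: "configuration S \<P> \<T>"
  shows "normalizable (S, \<P>, \<T>)"
proof (cases "\<T> = {}")
  case False
  then show ?thesis
    using normalizable_cone [OF c] c unfolding configuration_def by metis
next
  case T: True
  show ?thesis
  proof (cases "\<P> = {}")
    case True
    then show ?thesis using c T normalizable_points by (simp add: configuration_def)
  next
    case False
    then obtain P where P: "P \<in> \<P>" by blast
    show ?thesis
    proof (cases "\<P> = {P}")
      case True
      then show ?thesis using c T normalizable_one_plane by simp
    next
      case False
      then obtain Q where Q: "Q \<in> \<P>" "P \<noteq> Q" using P by blast
      show ?thesis
      proof (cases "\<P> = {P, Q}")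
        case True
        then show ?thesis using c T Q(2) normalizable_two_planes by simp
      next
        case False
        then obtain R where "R \<in> \<P>" "P \<noteq> R" "Q \<noteq> R" using P Q by blast
        then show ?thesis using normalizable_three_planes c T P Q by metis
      qed
    qed
  qed
qed

section \<open>Orbits\<close>

definition map_triple :: "(e3 \<Rightarrow> e3) \<Rightarrow> triple \<Rightarrow> triple" where
  "map_triple f = (\<lambda>(S, \<P>, \<T>). (f ` S, (`) f ` \<P>, (`) f ` \<T>))"

definition triple_collection :: "triple \<Rightarrow> e3 set set set" where
  "triple_collection = (\<lambda>(S, \<P>, \<T>). collection S \<P> \<T>)"

lemma Sp62D:
  assumes "f \<in> carrier Sp62"
  shows "f (x + y) = f x + f y" "f 0 = 0" "inj f" "surj f" "pairing (f x) (f y) = pairing x y"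
proof -
  show add: "f (x + y) = f x + f y" for x y
    using assms by (simp add: Sp62_def e3_linear_iff)
  show "f 0 = 0" using add [of 0 0] by simp
  show "inj f" "surj f" "pairing (f x) (f y) = pairing x y"
    using assms by (simp_all add: Sp62_def bij_def)
qed

lemma Sp62_image_perp:
  assumes "f \<in> carrier Sp62"
  shows "f ` perp X = perp (f ` X)"
proof -
  have perp_iff: "f y \<in> perp (f ` X) \<longleftrightarrow> y \<in> perp X" for y
    by (simp add: perp_def Sp62D(5) [OF assms])
  show ?thesis
  proof (rule Set.set_eqI)
    fix w
    obtain y where w: "w = f y" using Sp62D(4) [OF assms] by (rule surjE)
    show "w \<in> f ` perp X \<longleftrightarrow> w \<in> perp (f ` X)"
      unfolding w perp_iff by (rule inj_image_mem_iff [OF Sp62D(3) [OF assms]])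
  qed
qed

lemma act_collection:
  assumes f: "f \<in> carrier Sp62"
  shows "act f (collection S \<P> \<T>) = collection (f ` S) ((`) f ` \<P>) ((`) f ` \<T>)"
proof -
  have "(`) f ` members S \<P> \<T> = members (f ` S) ((`) f ` \<P>) ((`) f ` \<T>)"
    by (simp add: members_def image_Un image_image Sp62D(2) [OF f])
  then show ?thesis
    unfolding act_def collection_def
    by (simp add: image_image Sp62_image_perp [OF f] flip: \<open>(`) f ` members S \<P> \<T> = _\<close>)
qed

lemma act_triple_collection:
  "f \<in> carrier Sp62 \<Longrightarrow> act f (triple_collection t) = triple_collection (map_triple f t)"
  by (cases t) (simp add: triple_collection_def map_triple_def act_collection)

lemma map_triple_normal_forms:
  assumes f: "f \<in> carrier Sp62"
  shows "map (map_triple f) (normal_forms a1 b1 a2 b2 a3 b3) =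
    normal_forms (f a1) (f b1) (f a2) (f b2) (f a3) (f b3)"
proof -
  note f_simps = Sp62D(1,2) [OF f]
  have 2: "f ` span2 x y = span2 (f x) (f y)" for x y
    by (simp add: span2_def f_simps)
  have 3: "f ` span3 x y z = span3 (f x) (f y) (f z)" for x y z
    by (simp add: span3_eq f_simps)
  show ?thesis
    by (simp add: normal_forms_def point_forms_def cone_form_def side_forms_def upt_rec
        map_triple_def 2 3 f_simps)
qed

lemma symplectic_basis_image:
  assumes "f \<in> carrier Sp62" "symplectic_basis a1 b1 a2 b2 a3 b3"
  shows "symplectic_basis (f a1) (f b1) (f a2) (f b2) (f a3) (f b3)"
  using assms(2) unfolding symplectic_basis_def Sp62D(5) [OF assms(1)] .

lemma signature_map_triple:
  assumes f: "f \<in> carrier Sp62"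
  shows "signature (map_triple f t) = signature t"
proof -
  obtain S \<P> \<T> where t: "t = (S, \<P>, \<T>)" by (cases t)
  have inj: "inj f" by (rule Sp62D(3) [OF f])
  have inj': "inj ((`) f)" by (rule injI) (simp add: inj_image_eq_iff [OF inj])
  have card: "card (f ` X) = card X" "card ((`) f ` \<X>) = card \<X>" for X \<X>
    using inj_on_subset [OF inj] inj_on_subset [OF inj'] by (simp_all add: card_image)
  have 1: "f ` S \<inter> \<Union>((`) f ` \<P>) = f ` (S \<inter> \<Union>\<P>)" "f ` S \<inter> f ` T = f ` (S \<inter> T)" for T
    by (simp_all add: image_Int [OF inj] image_Union)
  have 2: "{P \<in> (`) f ` \<P>. P \<subseteq> f ` T} = (`) f ` {P \<in> \<P>. P \<subseteq> T}" for T
    by (auto simp: inj_image_subset_iff [OF inj])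
  have 3: "f u + f w \<in> f ` S \<longleftrightarrow> u + w \<in> S" for u w
    unfolding Sp62D(1) [OF f, symmetric] by (rule inj_image_mem_iff [OF inj])
  show ?thesis
    by (simp add: t signature_def map_triple_def card 1 2 3 inj_eq [OF inj] image_image)
qed

lemma triple_collection_eqD:
  assumes "symplectic_basis a1 b1 a2 b2 a3 b3" "t \<in> set (normal_forms a1 b1 a2 b2 a3 b3)"
    and "symplectic_basis a1' b1' a2' b2' a3' b3'" "t' \<in> set (normal_forms a1' b1' a2' b2' a3' b3')"
    and "triple_collection t = triple_collection t'"
  shows "t = t'"
proof -
  obtain S \<P> \<T> S' \<P>' \<T>' where t: "t = (S, \<P>, \<T>)" "t' = (S', \<P>', \<T>')"
    by (cases t, cases t')
  have c: "configuration S \<P> \<T>"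
    by (rule normal_forms_configuration [OF assms(1) assms(2) [unfolded t]])
  have c': "configuration S' \<P>' \<T>'"
    by (rule normal_forms_configuration [OF assms(3) assms(4) [unfolded t]])
  have eq: "collection S \<P> \<T> = collection S' \<P>' \<T>'"
    using assms(5) by (simp add: t triple_collection_def)
  show ?thesis
    unfolding t using points_collection [OF c, unfolded eq points_collection [OF c']]
      planes_collection [OF c, unfolded eq planes_collection [OF c']]
      cones_collection [OF c, unfolded eq cones_collection [OF c']] by simp
qed

theorem mainTheorem4:
  shows "card (orbits Sp62 {L. compatible L} act) = 43"
proof -
  interpret group_action Sp62 UNIV act by (rule Sp62_group_action)
  obtain a1 b1 a2 b2 a3 b3 where basis: "symplectic_basis a1 b1 a2 b2 a3 b3"
    using exists_symplectic_basis by blast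
  let ?N = "set (normal_forms a1 b1 a2 b2 a3 b3)"
  let ?orbit = "\<lambda>t. orbit Sp62 act (triple_collection t)"
  have orbit_act: "orbit Sp62 act (act f L) = orbit Sp62 act L" if f: "f \<in> carrier Sp62" for f L
  proof -
    have 1: "act f L \<in> orbit Sp62 act L" using f unfolding orbit_def by blast
    have 2: "L \<in> orbit Sp62 act (act f L)" by (rule orbit_sym [OF _ _ 1]) simp_all
    show ?thesis
    proof (intro subset_antisym subsetI)
      show "K \<in> orbit Sp62 act L" if "K \<in> orbit Sp62 act (act f L)" for K
        by (rule orbit_trans [OF _ _ _ 1 that]) simp_all
      show "K \<in> orbit Sp62 act (act f L)" if "K \<in> orbit Sp62 act L" for K
        by (rule orbit_trans [OF _ _ _ 2 that]) simp_all
    qed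
  qed
  have compat: "compatible (triple_collection t)" if "t \<in> ?N" for t
  proof -
    obtain S \<P> \<T> where t: "t = (S, \<P>, \<T>)" by (cases t)
    show ?thesis
      unfolding t triple_collection_def prod.case
      by (rule configuration_compatible [OF normal_forms_configuration [OF basis that [unfolded t]]])
  qed
  have ex: "\<exists>t\<in>?N. orbit Sp62 act L = ?orbit t" if L: "compatible L" for L
  proof -
    let ?t = "(points L, planes L, cones L)"
    have L_eq: "L = triple_collection ?t"
      using compatible_configuration(2) [OF L] by (simp add: triple_collection_def)
    obtain x1 y1 x2 y2 x3 y3 where b: "symplectic_basis x1 y1 x2 y2 x3 y3"
      and t: "?t \<in> set (normal_forms x1 y1 x2 y2 x3 y3)"
      using configuration_normalizable [OF compatible_configuration(1) [OF L]]
      unfolding normalizable_def by blast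
    obtain f where f: "f \<in> carrier Sp62" "f x1 = a1" "f y1 = b1" "f x2 = a2" "f y2 = b2"
      "f x3 = a3" "f y3 = b3"
      using Sp62_transitive [OF b basis] by blast
    have "map_triple f ?t \<in> ?N"
      using imageI [OF t, of "map_triple f"] map_triple_normal_forms [OF f(1), of x1 y1 x2 y2 x3 y3] f
      by (simp flip: set_map)
    moreover have "orbit Sp62 act L = ?orbit (map_triple f ?t)"
      using orbit_act [OF f(1), of L] act_triple_collection [OF f(1), of ?t] L_eq by metis
    ultimately show ?thesis by blast
  qed
  have inj: "t = t'" if t: "t \<in> ?N" and t': "t' \<in> ?N" and eq: "?orbit t = ?orbit t'" for t t'
  proof -
    have "triple_collection t' \<in> ?orbit t" using eq orbit_refl by simp
    then obtain f where f: "f \<in> carrier Sp62" "triple_collection t' = act f (triple_collection t)"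
      by (auto simp: orbit_def)
    have "map_triple f t \<in> set (normal_forms (f a1) (f b1) (f a2) (f b2) (f a3) (f b3))"
      using imageI [OF t, of "map_triple f"] by (simp flip: set_map add: map_triple_normal_forms [OF f(1)])
    then have "t' = map_triple f t"
      using triple_collection_eqD [OF basis t' symplectic_basis_image [OF f(1) basis]]
        f act_triple_collection [OF f(1), of t] by simp
    then have "signature t = signature t'" by (simp add: signature_map_triple [OF f(1)])
    then show ?thesis
      using distinct_signatures [OF basis] t t' by (simp add: distinct_map inj_on_def)
  qed
  have "orbits Sp62 {L. compatible L} act = ?orbit ` ?N"
    unfolding orbits_def using compat ex by blast
  moreover have "inj_on ?orbit ?N" using inj by (rule inj_onI)
  moreover have "card ?N = 43"
    using distinct_signatures [OF basis] distinct_card length_normal_forms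
    by (metis distinct_map)
  ultimately show ?thesis by (simp add: card_image)
qed

end
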